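(* Let $\mu\in X_*(A)$ be a dominant coweight and let $\nu\in\mathcal N_G$ be such that $\nu\le\mu$. Then the set $\mathbb A(F)_{\le\nu}$ is contained in $\mathbb A(F)_{\le\mu}$ with $k$-codimension $$\sum_{i=1}^l\lceil\langle\varpi_i,\mu-\nu\rangle\rceil,$$ where $\lceil t\rceil$ denotes the smallest integer greater than or equal to the real number $t$.
   Context: Field: $\mathcal O$ is a complete discrete valuation ring with uniformizer $\pi$ and algebraically closed residue field $k=\mathcal O/\pi\mathcal O$; $F$ is its fraction field. The convention is the negative of the usual valuation: $\mathrm{val}:F^\times\to\mathbb Z$ is normalized by $\mathrm{val}(\pi)=-1$, with $\mathrm{val}(0)=-\infty$. Group: $G$ is a split connected reductive group over $\mathcal O$ with simply connected derived group $G_{\mathrm{sc}}$; $A\subset B$ are a split maximal torus and a Borel subgroup (over $\mathcal O$); $W$ is the Weyl group of $A$ in $G$; $D=G/G_{\mathrm{sc}}$ (a split torus), $A_{\mathrm{sc}}=A\cap G_{\mathrm{sc}}$, so that $0\to X^*(D)\to X^*(A)\to X^*(A_{\mathrm{sc}})\to 0$ is exact. $\alpha_1,\dots,\alpha_l$ are the simple roots, with set $\Delta$; $\alpha_1^\vee,\dots,\alpha_l^\vee$ the simple coroots (a $\mathbb Z$-basis of $X_*(A_{\mathrm{sc}})$), $\varpi_1,\dots,\varpi_l\in X^*(A_{\mathrm{sc}})$ the dual basis (fundamental weights). For $1\le i\le l$, $\omega_i\in X^*(A)$ is a chosen extension of $\varpi_i$ to $A$, and $\omega_{l+1},\dots,\omega_n$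 is a chosen basis of $X^*(D)$, where $n=\dim A$. $\mathfrak a=X_*(A)\otimes\mathbb R$, with a fixed $W$-invariant Euclidean inner product. $x\in\mathfrak a$ is dominant if $\langle\alpha_i,x\rangle\ge0$ for $1\le i\le l$; $\mathfrak a_{\mathrm{dom}}$ is the set of dominant elements. For $x,y\in\mathfrak a$, $x\le y$ means that $y-x$ is a non-negative linear combination of simple coroots. The set $\mathcal N_G$: a standard parabolic $P=MN$ is a parabolic subgroup containing $B$, with unipotent radical $N$ and $M$ the Levi subgroup containing $A$; $\Delta=\Delta_M\sqcup\Delta_N$ with $\Delta_M$ the simple roots of $M$ and $\Delta_N$ the simple roots of $G$ occurring in $\mathrm{Lie}(N)$. $\mathfrak a_M=\{x\in\mathfrak a:\langle\alpha,x\rangle=0\ \forall\alpha\in\Delta_M\}$ (in particular $\mathfrak a_G=\{x:\langle\alpha_i,x\rangle=0\ \forall i\}$); $p_M:\mathfrak a\to\mathfrak a_M$ is the projection along the span of the simple coroots of $M$; $\Lambda_M$ is the quotient of $X_*(A)$ by the coroot lattice of $M$, identified with the lattice $p_M(X_*(A))\subset\mathfrak a_M$; $\mathfrak a_P^+=\{x\in\mathfrak a_M:\langle\alpha,x\rangle>0\ \forall\alpha\in\Delta_N\}$; $\Lambda_P^+=\Lambda_M\cap\mathfrak a_P^+$. Then $\mathcal N_G=\coprod_P\Lambda_P^+\subset\mathfrak a_{\mathrm{dom}}$, over all standard parabolic subgroups $P$; it contains every dominant element of $X_*(A)$. In the codimension formula, $\varpi_i$ is viewed as the unique element of $X^*(A)\otimes\mathbb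 Q$ with $\langle\varpi_i,\alpha_j^\vee\rangle=\delta_{ij}$ for $1\le j\le l$ and $\langle\varpi_i,x\rangle=0$ for all $x\in\mathfrak a_G$. Map $r$: for $x\in\mathfrak a$, $r(x)$ is the unique point of $\mathfrak a_{\mathrm{dom}}$ closest to $x$. Identify $\mathfrak a$ with $\mathbb R^n$ by $x\mapsto(\langle\omega_1,x\rangle,\dots,\langle\omega_n,x\rangle)$. Let $\tilde{\mathbb R}=\mathbb R\cup\{-\infty\}$, with the intervals $[-\infty,a)$ as neighborhood base at $-\infty$; $r$ extends (uniquely) to a continuous map, still called $r$, $\tilde{\mathbb R}^l\times\mathbb R^{n-l}\to\mathfrak a_{\mathrm{dom}}$. Adjoint quotient: $\mathbb A=A/W$ is identified with $\mathbb A^l\times\mathbb G_m^{n-l}$ by the functions $c_i=\sum_{\lambda\in W\omega_i}e^\lambda$ ($1\le i\le n$; $e^\lambda$ is $\lambda$ viewed as a regular function on $A$), so $\mathbb A(F)=F^l\times(F^\times)^{n-l}$. For $c=(c_1,\dots,c_n)\in\mathbb A(F)$ put $d_c=(\mathrm{val}\,c_1,\dots,\mathrm{val}\,c_n)$. For $\mu\in\mathcal N_G$, $\mathbb A(F)_{\le\mu}=\{c\in\mathbb A(F):r(d_c)\le\mu\}$. Dimensions: put $P^j=\pi^j\mathcal O$. For integers $j_1,\dots,j_l$ and a coset $C$ of $(\mathcal O^\times)^{n-l}$ in $(F^\times)^{n-l}$, the subset $P^{j_1}\times\dots\times P^{j_l}\times C$ of $\mathbb A(F)$ is assigned the ($k$-)dimension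 $-(j_1+\dots+j_l)$. Each $\mathbb A(F)_{\le\mu}$ is a subset of this form, and the $k$-codimension of one such subset in another one containing it (with the same $C$) is the difference of their dimensions. *)

theory Defs
  imports
    "HOL-Analysis.Analysis"
    "HOL-Library.Poly_Mapping"
    "HOL-Algebra.Algebraic_Closure"
begin

section \<open>Complete discrete valuation rings\<close>

text \<open>
  The ring is given inside its fraction field \<open>'f\<close> by the normalised valuation.  The sign is
  the negative of the usual one: \<open>val \<pi> = -1\<close> and \<open>val 0 = -\<infinity>\<close>.
\<close>

definition discrete_valuation :: "('f::field \<Rightarrow> ereal) \<Rightarrow> bool" where
  "discrete_valuation val \<longleftrightarrow>
     val 0 = -\<infinity> \<and>
     (\<forall>x. x \<noteq> 0 \<longrightarrow> (\<exists>m::int. val x = ereal (of_int m))) \<and>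
     (\<forall>x y. val (x * y) = val x + val y) \<and>
     (\<forall>x y. val (x + y) \<le> max (val x) (val y))"

definition val_ring :: "('f::field \<Rightarrow> ereal) \<Rightarrow> 'f set" where
  "val_ring val = {x. val x \<le> 0}"

definition val_units :: "('f::field \<Rightarrow> ereal) \<Rightarrow> 'f set" where
  "val_units val = {u \<in> val_ring val. u \<noteq> 0 \<and> inverse u \<in> val_ring val}"

definition pi_power :: "('f::field \<Rightarrow> ereal) \<Rightarrow> 'f \<Rightarrow> int \<Rightarrow> 'f set" where
  "pi_power val \<pi> j = {(\<pi> powi j) * x |x. x \<in> val_ring val}"

definition val_complete :: "('f::field \<Rightarrow> ereal) \<Rightarrow> 'f \<Rightarrow> bool" where
  "val_complete val \<pi> \<longleftrightarrow>
     (\<forall>s::nat \<Rightarrow> 'f.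
        range s \<subseteq> val_ring val \<and>
        (\<forall>N::nat. \<exists>M. \<forall>m\<ge>M. \<forall>n\<ge>M. s m - s n \<in> pi_power val \<pi> (int N)) \<longrightarrow>
        (\<exists>x\<in>val_ring val. \<forall>N::nat. \<exists>M. \<forall>m\<ge>M. s m - x \<in> pi_power val \<pi> (int N)))"

definition val_ring_struct :: "('f::field \<Rightarrow> ereal) \<Rightarrow> 'f ring" where
  "val_ring_struct val =
     \<lparr>carrier = val_ring val, mult = (*), one = 1, zero = 0, add = (+)\<rparr>"

definition residue_field :: "('f::field \<Rightarrow> ereal) \<Rightarrow> 'f \<Rightarrow> 'f set ring" where
  "residue_field val \<pi> = val_ring_struct val Quot (PIdl\<^bsub>val_ring_struct val\<^esub> \<pi>)"

definition complete_dvr :: "('f::field \<Rightarrow> ereal) \<Rightarrow> 'f \<Rightarrow> bool" where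
  "complete_dvr val \<pi> \<longleftrightarrow>
     discrete_valuation val \<and> val \<pi> = -1 \<and> val_complete val \<pi> \<and>
     algebraically_closed (residue_field val \<pi>)"


section \<open>Based root data\<close>

text \<open>
  A split connected reductive group \<open>G \<supseteq> B \<supseteq> A\<close> is given by its reduced based root datum.
  The lattices \<open>X\<^sup>*(A)\<close> and \<open>X\<^sub>*(A)\<close> are both \<open>\<int>\<^sup>n\<close>, in perfect duality through the standard
  pairing below.  Hence \<open>\<aa> = X\<^sub>*(A) \<otimes> \<real>\<close> and \<open>X\<^sup>*(A) \<otimes> \<real>\<close> are both \<open>\<real>\<^sup>n\<close>, dual to each other
  through the same pairing, which has nothing to do with the \<open>W\<close>-invariant inner product on \<open>\<aa>\<close>.
\<close>

definition pairing :: "'a::comm_ring_1 ^ 'n \<Rightarrow> 'a ^ 'n \<Rightarrow> 'a" where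
  "pairing l x = (\<Sum>k\<in>UNIV. l $ k * x $ k)"

definition rvec :: "int ^ 'n \<Rightarrow> real ^ 'n" where
  "rvec y = (\<chi> k. of_int (y $ k))"

text \<open>
  The simple roots are indexed by a subset \<open>sidx\<close> of the index type \<open>'n\<close> (of cardinality \<open>n\<close>);
  it plays the role of \<open>{1, \<dots>, l}\<close>, and its complement that of \<open>{l + 1, \<dots>, n}\<close>.
\<close>

record 'n rdatum =
  roots :: "(int ^ 'n) set"
  coroot :: "int ^ 'n \<Rightarrow> int ^ 'n"
  sidx :: "'n set"
  sroot :: "'n \<Rightarrow> int ^ 'n"

definition scoroot :: "'n::finite rdatum \<Rightarrow> 'n \<Rightarrow> int ^ 'n" where
  "scoroot G i = coroot G (sroot G i)"

definition char_refl :: "'a::comm_ring_1 ^ 'n \<Rightarrow> 'a ^ 'n \<Rightarrow> 'a ^ 'n \<Rightarrow> 'a ^ 'n" where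
  "char_refl a b l = l - pairing l b *s a"

definition cochar_refl :: "'a::comm_ring_1 ^ 'n \<Rightarrow> 'a ^ 'n \<Rightarrow> 'a ^ 'n \<Rightarrow> 'a ^ 'n" where
  "cochar_refl a b x = x - pairing a x *s b"

definition reduced_root_datum :: "'n::finite rdatum \<Rightarrow> bool" where
  "reduced_root_datum G \<longleftrightarrow>
     finite (roots G) \<and> inj_on (coroot G) (roots G) \<and>
     (\<forall>a\<in>roots G. pairing a (coroot G a) = 2 \<and>
        char_refl a (coroot G a) ` roots G = roots G \<and>
        cochar_refl a (coroot G a) ` (coroot G ` roots G) = coroot G ` roots G \<and>
        2 *s a \<notin> roots G)"

definition root_base :: "'n::finite rdatum \<Rightarrow> bool" where
  "root_base G \<longleftrightarrow>
     sroot G ` sidx G \<subseteq> roots G \<and>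
     (\<forall>m. (\<Sum>i\<in>sidx G. m i *s sroot G i) = 0 \<longrightarrow> (\<forall>i\<in>sidx G. m i = 0)) \<and>
     (\<forall>a\<in>roots G. \<exists>m. a = (\<Sum>i\<in>sidx G. m i *s sroot G i) \<and>
        ((\<forall>i\<in>sidx G. 0 \<le> m i) \<or> (\<forall>i\<in>sidx G. m i \<le> 0)))"

definition coroot_lattice :: "'n::finite rdatum \<Rightarrow> (int ^ 'n) set" where
  "coroot_lattice G = {\<Sum>a\<in>roots G. m a *s coroot G a |m. True}"

text \<open>
  \<open>X\<^sub>*(A \<inter> G\<^sub>d\<^sub>e\<^sub>r)\<close> consists of the cocharacters with a nonzero multiple in the coroot lattice;
  the derived group is simply connected iff this is the coroot lattice itself.
\<close>

definition simply_connected_derived :: "'n::finite rdatum \<Rightarrow> bool" where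
  "simply_connected_derived G \<longleftrightarrow>
     (\<forall>y. (\<exists>k. k \<noteq> 0 \<and> k *s y \<in> coroot_lattice G) \<longrightarrow> y \<in> coroot_lattice G)"

definition split_reductive_sc :: "'n::finite rdatum \<Rightarrow> bool" where
  "split_reductive_sc G \<longleftrightarrow>
     reduced_root_datum G \<and> root_base G \<and> simply_connected_derived G"

text \<open>The characters of \<open>D = G/G\<^sub>s\<^sub>c\<close>, as a subgroup of \<open>X\<^sup>*(A)\<close>.\<close>

definition chars_D :: "'n::finite rdatum \<Rightarrow> (int ^ 'n) set" where
  "chars_D G = {l. \<forall>a\<in>roots G. pairing l (coroot G a) = 0}"

text \<open>
  For \<open>i\<close> in \<open>sidx\<close> the character \<open>\<omega> i\<close> restricts to the fundamental weight \<open>\<varpi>\<^sub>i\<close> on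
  \<open>A\<^sub>s\<^sub>c\<close>; the remaining \<open>\<omega> i\<close> form a \<open>\<int>\<close>-basis of \<open>X\<^sup>*(D)\<close>.
\<close>

definition extended_weights :: "'n::finite rdatum \<Rightarrow> ('n \<Rightarrow> int ^ 'n) \<Rightarrow> bool" where
  "extended_weights G \<omega> \<longleftrightarrow>
     (\<forall>i\<in>sidx G. \<forall>j\<in>sidx G. pairing (\<omega> i) (scoroot G j) = (if i = j then 1 else 0)) \<and>
     \<omega> ` (- sidx G) \<subseteq> chars_D G \<and>
     (\<forall>l\<in>chars_D G. \<exists>m. l = (\<Sum>i\<in>- sidx G. m i *s \<omega> i)) \<and>
     (\<forall>m. (\<Sum>i\<in>- sidx G. m i *s \<omega> i) = 0 \<longrightarrow> (\<forall>i\<in>- sidx G. m i = 0))"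


section \<open>The Weyl group\<close>

text \<open>Products of elements of \<open>S\<close>; this is the generated group, as \<open>S\<close> will consist of involutions.\<close>

inductive_set gen_by :: "('a \<Rightarrow> 'a) set \<Rightarrow> ('a \<Rightarrow> 'a) set" for S where
  gen_id: "id \<in> gen_by S"
| gen_step: "s \<in> S \<Longrightarrow> w \<in> gen_by S \<Longrightarrow> s \<circ> w \<in> gen_by S"

definition weyl_char :: "'n::finite rdatum \<Rightarrow> (int ^ 'n \<Rightarrow> int ^ 'n) set" where
  "weyl_char G = gen_by {char_refl a (coroot G a) |a. a \<in> roots G}"

definition weyl_a :: "'n::finite rdatum \<Rightarrow> (real ^ 'n \<Rightarrow> real ^ 'n) set" where
  "weyl_a G = gen_by {cochar_refl (rvec a) (rvec (coroot G a)) |a. a \<in> roots G}"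

definition weyl_inner :: "'n::finite rdatum \<Rightarrow> (real ^ 'n \<Rightarrow> real ^ 'n \<Rightarrow> real) \<Rightarrow> bool" where
  "weyl_inner G ip \<longleftrightarrow>
     bilinear ip \<and> (\<forall>x y. ip x y = ip y x) \<and> (\<forall>x. x \<noteq> 0 \<longrightarrow> 0 < ip x x) \<and>
     (\<forall>w\<in>weyl_a G. \<forall>x y. ip (w x) (w y) = ip x y)"


section \<open>Dominance and the set \<open>\<N>\<^sub>G\<close>\<close>

definition a_dom :: "'n::finite rdatum \<Rightarrow> (real ^ 'n) set" where
  "a_dom G = {x. \<forall>i\<in>sidx G. 0 \<le> pairing (rvec (sroot G i)) x}"

definition dom_le :: "'n::finite rdatum \<Rightarrow> real ^ 'n \<Rightarrow> real ^ 'n \<Rightarrow> bool" where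
  "dom_le G x y \<longleftrightarrow>
     (\<exists>c. (\<forall>i\<in>sidx G. 0 \<le> c i) \<and> y - x = (\<Sum>i\<in>sidx G. c i *\<^sub>R rvec (scoroot G i)))"

text \<open>
  Standard parabolic subgroups \<open>P = MN\<close> correspond to the subsets \<open>K\<close> of \<open>sidx\<close>, the simple
  roots of \<open>M\<close> being those with index in \<open>K\<close>; \<open>K = sidx\<close> is \<open>P = G\<close>.
\<close>

definition a_M :: "'n::finite rdatum \<Rightarrow> 'n set \<Rightarrow> (real ^ 'n) set" where
  "a_M G K = {x. \<forall>i\<in>K. pairing (rvec (sroot G i)) x = 0}"

definition p_M :: "'n::finite rdatum \<Rightarrow> 'n set \<Rightarrow> real ^ 'n \<Rightarrow> real ^ 'n" where
  "p_M G K x = (THE y. y \<in> a_M G K \<and> x - y \<in> span ((\<lambda>i. rvec (scoroot G i)) ` K))"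

definition Lambda_M :: "'n::finite rdatum \<Rightarrow> 'n set \<Rightarrow> (real ^ 'n) set" where
  "Lambda_M G K = range (\<lambda>y. p_M G K (rvec y))"

definition a_P_plus :: "'n::finite rdatum \<Rightarrow> 'n set \<Rightarrow> (real ^ 'n) set" where
  "a_P_plus G K = {x \<in> a_M G K. \<forall>i\<in>sidx G - K. 0 < pairing (rvec (sroot G i)) x}"

definition N_G :: "'n::finite rdatum \<Rightarrow> (real ^ 'n) set" where
  "N_G G = (\<Union>K\<in>Pow (sidx G). Lambda_M G K \<inter> a_P_plus G K)"

definition varpi :: "'n::finite rdatum \<Rightarrow> 'n \<Rightarrow> real ^ 'n" where
  "varpi G i = (THE l. (\<forall>k. l $ k \<in> \<rat>) \<and>
     (\<forall>j\<in>sidx G. pairing l (rvec (scoroot G j)) = (if i = j then 1 else 0)) \<and>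
     (\<forall>x\<in>a_M G (sidx G). pairing l x = 0))"


section \<open>The retraction \<open>r\<close> and its extension\<close>

definition retr :: "'n::finite rdatum \<Rightarrow> (real ^ 'n \<Rightarrow> real ^ 'n \<Rightarrow> real) \<Rightarrow> real ^ 'n \<Rightarrow> real ^ 'n" where
  "retr G ip x =
     (THE y. y \<in> a_dom G \<and> (\<forall>z\<in>a_dom G. ip (x - y) (x - y) \<le> ip (x - z) (x - z)))"

definition a_coords :: "('n::finite \<Rightarrow> int ^ 'n) \<Rightarrow> real ^ 'n \<Rightarrow> ereal ^ 'n" where
  "a_coords \<omega> x = (\<chi> i. ereal (pairing (rvec (\<omega> i)) x))"

definition ext_domain :: "'n::finite rdatum \<Rightarrow> (ereal ^ 'n) set" where
  "ext_domain G =
     {d. (\<forall>i\<in>sidx G. d $ i \<noteq> \<infinity>) \<and> (\<forall>i\<in>- sidx G. d $ i \<noteq> \<infinity> \<and> d $ i \<noteq> -\<infinity>)}"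

text \<open>
  The continuous extension is unique on \<open>ext_domain G\<close>, since the points with finite coordinates
  are dense there; only its values on that set are ever used.
\<close>

definition retr_ext ::
    "'n::finite rdatum \<Rightarrow> (real ^ 'n \<Rightarrow> real ^ 'n \<Rightarrow> real) \<Rightarrow> ('n \<Rightarrow> int ^ 'n) \<Rightarrow>
     ereal ^ 'n \<Rightarrow> real ^ 'n" where
  "retr_ext G ip \<omega> =
     (SOME f. continuous_on (ext_domain G) f \<and> f ` ext_domain G \<subseteq> a_dom G \<and>
        (\<forall>x. f (a_coords \<omega> x) = retr G ip x))"


section \<open>The adjoint quotient \<open>\<AA> = A/W\<close>\<close>

text \<open>
  The group algebra of \<open>X\<^sup>*(A)\<close> over \<open>'f\<close> is the convolution algebra of finitely supported
  functions.  The coordinate ring of \<open>A/W\<close> consists of its \<open>W\<close>-invariant elements with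
  coefficients in the valuation ring, and an \<open>F\<close>-point of \<open>A/W\<close> is a homomorphism of algebras
  over the valuation ring from it to \<open>F\<close> (set to \<open>undefined\<close> outside the coordinate ring).
\<close>

definition inv_ring ::
    "'n::finite rdatum \<Rightarrow> ('f::field \<Rightarrow> ereal) \<Rightarrow> (int ^ 'n \<Rightarrow>\<^sub>0 'f) set" where
  "inv_ring G val =
     {p. (\<forall>l. Poly_Mapping.lookup p l \<in> val_ring val) \<and>
         (\<forall>w\<in>weyl_char G. \<forall>l. Poly_Mapping.lookup p (w l) = Poly_Mapping.lookup p l)}"

definition adj_points ::
    "'n::finite rdatum \<Rightarrow> ('f::field \<Rightarrow> ereal) \<Rightarrow> ((int ^ 'n \<Rightarrow>\<^sub>0 'f) \<Rightarrow> 'f) set" where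
  "adj_points G val =
     {c \<in> extensional (inv_ring G val).
        (\<forall>a\<in>val_ring val. c (Poly_Mapping.single 0 a) = a) \<and>
        (\<forall>p\<in>inv_ring G val. \<forall>q\<in>inv_ring G val.
           c (p + q) = c p + c q \<and> c (p * q) = c p * c q)}"

definition orbit_sum ::
    "'n::finite rdatum \<Rightarrow> int ^ 'n \<Rightarrow> (int ^ 'n \<Rightarrow>\<^sub>0 'f::field)" where
  "orbit_sum G l = (\<Sum>l'\<in>{w l |w. w \<in> weyl_char G}. Poly_Mapping.single l' 1)"

text \<open>
  The coordinates \<open>c\<^sub>i\<close> of a point; they identify \<open>\<AA>(F)\<close> with
  \<open>F\<^sup>l \<times> (F\<^sup>\<times>)\<^bsup>n-l\<^esup>\<close>.
\<close>

definition adj_coord ::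
    "'n::finite rdatum \<Rightarrow> ('n \<Rightarrow> int ^ 'n) \<Rightarrow> ((int ^ 'n \<Rightarrow>\<^sub>0 'f::field) \<Rightarrow> 'f) \<Rightarrow> 'n \<Rightarrow> 'f" where
  "adj_coord G \<omega> c i = c (orbit_sum G (\<omega> i))"

definition d_vec ::
    "'n::finite rdatum \<Rightarrow> ('f::field \<Rightarrow> ereal) \<Rightarrow> ('n \<Rightarrow> int ^ 'n) \<Rightarrow>
     ((int ^ 'n \<Rightarrow>\<^sub>0 'f) \<Rightarrow> 'f) \<Rightarrow> ereal ^ 'n" where
  "d_vec G val \<omega> c = (\<chi> i. val (adj_coord G \<omega> c i))"

definition adj_le ::
    "'n::finite rdatum \<Rightarrow> ('f::field \<Rightarrow> ereal) \<Rightarrow> (real ^ 'n \<Rightarrow> real ^ 'n \<Rightarrow> real) \<Rightarrow>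
     ('n \<Rightarrow> int ^ 'n) \<Rightarrow> real ^ 'n \<Rightarrow> ((int ^ 'n \<Rightarrow>\<^sub>0 'f) \<Rightarrow> 'f) set" where
  "adj_le G val ip \<omega> \<mu> =
     {c \<in> adj_points G val. dom_le G (retr_ext G ip \<omega> (d_vec G val \<omega> c)) \<mu>}"


section \<open>Dimensions and codimensions\<close>

text \<open>
  \<open>adj_box G val \<pi> \<omega> j t\<close> is \<open>P\<^bsup>j 1\<^esup> \<times> \<dots> \<times> P\<^bsup>j l\<^esup> \<times> C\<close>, where \<open>C\<close> is the coset of
  \<open>t\<close>, for \<open>t\<close> nonzero outside \<open>sidx\<close>.
\<close>

definition adj_box ::
    "'n::finite rdatum \<Rightarrow> ('f::field \<Rightarrow> ereal) \<Rightarrow> 'f \<Rightarrow> ('n \<Rightarrow> int ^ 'n) \<Rightarrow>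
     ('n \<Rightarrow> int) \<Rightarrow> ('n \<Rightarrow> 'f) \<Rightarrow> ((int ^ 'n \<Rightarrow>\<^sub>0 'f) \<Rightarrow> 'f) set" where
  "adj_box G val \<pi> \<omega> j t =
     {c \<in> adj_points G val.
        (\<forall>i\<in>sidx G. adj_coord G \<omega> c i \<in> pi_power val \<pi> (j i)) \<and>
        (\<forall>i\<in>- sidx G. \<exists>u\<in>val_units val. adj_coord G \<omega> c i = t i * u)}"

definition box_dim :: "'n::finite rdatum \<Rightarrow> ('n \<Rightarrow> int) \<Rightarrow> int" where
  "box_dim G j = - (\<Sum>i\<in>sidx G. j i)"

text \<open>
  The exponents \<open>j\<close> (on \<open>sidx\<close>) and the coset of a box are determined by the box, because the
  coordinates \<open>c\<^sub>i\<close> identify \<open>\<AA>(F)\<close> with \<open>F\<^sup>l \<times> (F\<^sup>\<times>)\<^bsup>n-l\<^esup>\<close>; so the codimension \<open>d\<close> is unique.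
\<close>

definition has_codim ::
    "'n::finite rdatum \<Rightarrow> ('f::field \<Rightarrow> ereal) \<Rightarrow> 'f \<Rightarrow> ('n \<Rightarrow> int ^ 'n) \<Rightarrow>
     ((int ^ 'n \<Rightarrow>\<^sub>0 'f) \<Rightarrow> 'f) set \<Rightarrow> ((int ^ 'n \<Rightarrow>\<^sub>0 'f) \<Rightarrow> 'f) set \<Rightarrow> int \<Rightarrow> bool" where
  "has_codim G val \<pi> \<omega> S T d \<longleftrightarrow>
     S \<subseteq> T \<and>
     (\<exists>j j' t. (\<forall>i\<in>- sidx G. t i \<noteq> 0) \<and>
        S = adj_box G val \<pi> \<omega> j t \<and> T = adj_box G val \<pi> \<omega> j' t \<and>
        d = box_dim G j' - box_dim G j)"

end

theory Submission
  imports Defs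
begin

text \<open>
  The point is that \<open>\<AA>(F)\<^bsub>\<le>\<lambda>\<^esub>\<close>, for dominant \<open>\<lambda>\<close>, is cut out by inequalities on the individual
  coordinates: \<open>val c\<^sub>i \<le> \<langle>\<omega>\<^sub>i, \<lambda>\<rangle>\<close> for \<open>i \<le> l\<close> and \<open>val c\<^sub>j = \<langle>\<omega>\<^sub>j, \<lambda>\<rangle>\<close> for \<open>j > l\<close>.  Since valuations are
  integers, this is the box with exponents \<open>j\<^sub>i = - \<lfloor>\<langle>\<omega>\<^sub>i, \<lambda>\<rangle>\<rfloor>\<close> (lemma \<open>adj_le_eq_box\<close>).  If \<open>\<nu> \<le> \<mu>\<close>, then
  \<open>\<mu> - \<nu>\<close> is a combination of simple coroots, so \<open>\<nu>\<close> and \<open>\<mu>\<close> give the same coset of units, and \<open>\<omega>\<^sub>i\<close> and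
  \<open>\<varpi>\<^sub>i\<close> agree on \<open>\<mu> - \<nu>\<close> (lemma \<open>varpi_eq_wt\<close>).  As \<open>\<langle>\<omega>\<^sub>i, \<mu>\<rangle>\<close> is an integer, the difference of dimensions
  is \<open>\<Sum> (\<langle>\<omega>\<^sub>i, \<mu>\<rangle> - \<lfloor>\<langle>\<omega>\<^sub>i, \<nu>\<rangle>\<rfloor>) = \<Sum> \<lceil>\<langle>\<varpi>\<^sub>i, \<mu> - \<nu>\<rangle>\<rceil>\<close>.

  The coordinatewise description rests on the fact that \<open>r x\<close> is the least dominant element above
  \<open>x\<close>: \<open>r x \<le> \<lambda>\<close> if and only if \<open>x \<le> \<lambda>\<close> (lemma \<open>retr_le_iff\<close>).  The variational inequality for the
  nearest point gives \<open>x \<le> r x\<close>, with equality in each coordinate where \<open>r x\<close> is off the wall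
  (lemma \<open>retr_weights\<close>); and because distinct simple coroots make obtuse angles, a combination of
  coroots that pairs non-negatively with \<open>\<alpha>\<^sub>i\<close> wherever its \<open>i\<close>th coefficient is negative has in fact no
  negative coefficient (lemma \<open>weights_nonneg\<close>).

  The same positivity lemma explains why \<open>r\<close> extends to infinite coordinates.  A dominant element
  lies above the point of \<open>\<aa>\<^sub>G\<close> with the same \<open>D\<close>-coordinates.  So raising the first \<open>l\<close> coordinates of
  \<open>x\<close> to at least those of this point does not change the dominant elements above \<open>x\<close>, hence does not
  change \<open>r x\<close>; but the raised coordinates stay finite when a coordinate of \<open>x\<close> tends to \<open>-\<infinity>\<close>.
  The extension is thus \<open>r\<close> composed with a continuous map \<open>lift\<close> (lemma \<open>retr_ext_eq\<close>).
\<close>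

section \<open>Preliminaries on lattices and matrices\<close>

lemma pairing_eq_inner: "pairing l x = l \<bullet> (x :: real ^ 'n)"
  by (simp add: pairing_def inner_vec_def)

lemma rvec_inner: "rvec a \<bullet> rvec b = of_int (pairing a b)"
  by (simp add: rvec_def pairing_def inner_vec_def)

lemma pairing_sum_left:
  "pairing (\<Sum>i\<in>S. m i *s f i) y = (\<Sum>i\<in>S. m i * pairing (f i) y)"
  for y :: "int ^ 'n"
proof -
  have "pairing (\<Sum>i\<in>S. m i *s f i) y = (\<Sum>k\<in>UNIV. \<Sum>i\<in>S. m i * f i $ k * y $ k)"
    by (simp add: pairing_def sum_component sum_distrib_right)
  also have "\<dots> = (\<Sum>i\<in>S. \<Sum>k\<in>UNIV. m i * f i $ k * y $ k)" by (rule sum.swap)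
  finally show ?thesis by (simp add: pairing_def sum_distrib_left mult.assoc)
qed

definition rmat :: "int ^ 'n ^ 'n \<Rightarrow> real ^ 'n ^ 'n" where
  "rmat A = (\<chi> i. rvec (A $ i))"

lemma rmat_mult_nth: "(rmat A *v x) $ i = rvec (A $ i) \<bullet> x"
  by (simp add: rmat_def matrix_vector_mult_def inner_vec_def)

lemma det_rmat: "det (rmat A) = of_int (det A)" for A :: "int ^ 'n::finite ^ 'n"
  by (simp add: rmat_def det_def rvec_def)

lemma common_denominator:
  fixes x :: "'a::finite \<Rightarrow> rat"
  obtains d :: int and m where "d \<noteq> 0" "\<And>i. of_int d * x i = of_int (m i)"
proof -
  define q where "q i = snd (quotient_of (x i))" for i
  have q: "q i > 0" "of_int (q i) * x i = of_int (fst (quotient_of (x i)))" for i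
  proof -
    show "q i > 0" using quotient_of_denom_pos'[of "x i"] by (simp add: q_def)
    then show "of_int (q i) * x i = of_int (fst (quotient_of (x i)))"
      using quotient_of_div[of "x i" "fst (quotient_of (x i))" "q i"]
      by (simp add: q_def nonzero_eq_divide_eq mult.commute)
  qed
  show thesis
  proof (rule that[of "prod q UNIV" "\<lambda>i. prod q (UNIV - {i}) * fst (quotient_of (x i))"])
    show "prod q UNIV \<noteq> 0" using q(1) by (simp add: less_imp_neq[symmetric])
    fix i
    have "prod q UNIV = prod q (UNIV - {i}) * q i"
      by (simp add: prod.remove[of UNIV i] mult.commute)
    then show "of_int (prod q UNIV) * x i =
        of_int (prod q (UNIV - {i}) * fst (quotient_of (x i)))"
      using q(2)[of i] by (simp add: mult.assoc)
  qed
qed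

text \<open>
  A rational relation among the rows becomes an integral one after clearing denominators, so
  independence over \<open>\<int>\<close> already makes the determinant nonzero.
\<close>

lemma det_nonzero_of_int_independent_rows:
  fixes A :: "int ^ 'n::finite ^ 'n"
  assumes indep: "\<And>m. (\<Sum>i\<in>UNIV. m i *s A $ i) = 0 \<Longrightarrow> \<forall>i. m i = 0"
  shows "det A \<noteq> 0"
proof
  assume det0: "det A = 0"
  define B :: "rat ^ 'n ^ 'n" where "B = (\<chi> i j. of_int (A $ j $ i))"
  have "det B = of_int (det (transpose A))"
    by (simp add: B_def det_def transpose_def)
  then have "det B = 0" by (simp add: det0)
  then have "\<not> (\<forall>x. B *v x = 0 \<longrightarrow> x = 0)"
    using invertible_det_nz[of B] invertible_left_inverse[of B] matrix_left_invertible_ker[of B]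
    by auto
  then obtain x where x: "B *v x = 0" "x \<noteq> 0" by auto
  obtain d m where d: "d \<noteq> 0" and m: "\<And>i. of_int d * x $ i = of_int (m i)"
    using common_denominator[of "\<lambda>i. x $ i"] by metis
  have "(\<Sum>i\<in>UNIV. m i *s A $ i) $ k = 0" for k
  proof -
    have "(of_int ((\<Sum>i\<in>UNIV. m i *s A $ i) $ k) :: rat)
        = (\<Sum>i\<in>UNIV. of_int (m i) * of_int (A $ i $ k))"
      by (simp add: sum_component)
    also have "\<dots> = of_int d * (\<Sum>i\<in>UNIV. of_int (A $ i $ k) * x $ i)"
      by (simp add: m[symmetric] sum_distrib_left mult_ac)
    also have "(\<Sum>i\<in>UNIV. of_int (A $ i $ k) * x $ i) = (B *v x) $ k"
      by (simp add: B_def matrix_vector_mult_def)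
    finally have "(of_int ((\<Sum>i\<in>UNIV. m i *s A $ i) $ k) :: rat) = 0" by (simp add: x(1))
    then show ?thesis by (simp only: of_int_eq_0_iff)
  qed
  then have "(\<Sum>i\<in>UNIV. m i *s A $ i) = 0" by (simp add: vec_eq_iff)
  then have "\<forall>i. m i = 0" by (rule indep)
  then have "x = 0" using d m by (simp add: vec_eq_iff)
  with x(2) show False by simp
qed

text \<open>
  By Cramer's rule the entries of a solution are quotients of integral determinants.
\<close>

lemma rmat_solution_rational:
  assumes "det A \<noteq> 0" "rmat A *v x = rvec b"
  shows "x $ k \<in> \<rat>"
proof -
  have "x = (\<chi> k. det (\<chi> i j. if j = k then rvec b $ i else rmat A $ i $ j) / det (rmat A))"
    using cramer[of "rmat A" x "rvec b"] assms by (simp add: det_rmat)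
  moreover have "(\<chi> i j. if j = k then rvec b $ i else rmat A $ i $ j)
      = rmat (\<chi> i j. if j = k then b $ i else A $ i $ j)"
    by (simp add: rmat_def rvec_def vec_eq_iff)
  ultimately show ?thesis by (simp add: det_rmat)
qed

lemma rmat_surj:
  assumes "det A \<noteq> 0"
  obtains x where "rmat A *v x = b"
proof -
  have "det (rmat A) \<noteq> 0" using assms by (simp add: det_rmat)
  from cramer[OF this, THEN iffD2, OF refl] show thesis by (rule that)
qed

lemma rmat_inj:
  assumes "det A \<noteq> 0" "rmat A *v x = 0"
  shows "x = 0"
proof -
  have "invertible (rmat A)" using assms(1) by (simp add: invertible_det_nz det_rmat)
  then show ?thesis
    using assms(2) invertible_left_inverse matrix_left_invertible_ker by blast
qed

lemma char_refl_involution: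
  fixes a b l :: "int ^ 'n"
  assumes "pairing a b = 2"
  shows "char_refl a b (char_refl a b l) = l"
proof -
  have "pairing (l - c *s a) b = pairing l b - c * 2" for c
    using assms
    by (simp add: pairing_def left_diff_distrib sum_subtractf sum_distrib_left mult.assoc)
      (simp add: sum_distrib_left[symmetric])
  then show ?thesis
    unfolding char_refl_def by (simp only:) (simp add: vec_eq_iff algebra_simps)
qed

lemma continuous_on_real_of_ereal:
  fixes f :: "'b::topological_space \<Rightarrow> ereal"
  assumes "continuous_on S f" "\<And>x. x \<in> S \<Longrightarrow> \<bar>f x\<bar> \<noteq> \<infinity>"
  shows "continuous_on S (\<lambda>x. real_of_ereal (f x))"
  unfolding continuous_on_def
proof
  fix x assume x: "x \<in> S"
  have "(f \<longlongrightarrow> ereal (real_of_ereal (f x))) (at x within S)"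
    using assms x by (simp add: continuous_on_def ereal_real')
  then show "((\<lambda>x. real_of_ereal (f x)) \<longlongrightarrow> real_of_ereal (f x)) (at x within S)"
    by (rule lim_real_of_ereal)
qed

section \<open>Coroots, weights and the inner product\<close>

locale split_datum =
  fixes G :: "'n::finite rdatum"
    and \<omega> :: "'n \<Rightarrow> int ^ 'n"
    and ip :: "real ^ 'n \<Rightarrow> real ^ 'n \<Rightarrow> real"
  assumes datum: "split_reductive_sc G"
    and weights: "extended_weights G \<omega>"
    and inner: "weyl_inner G ip"
begin

abbreviation I where "I \<equiv> sidx G"
abbreviation rt where "rt i \<equiv> rvec (sroot G i)"
abbreviation cr where "cr i \<equiv> rvec (scoroot G i)"
abbreviation wt where "wt i \<equiv> rvec (\<omega> i)"

lemma sroot_in_roots: "i \<in> I \<Longrightarrow> sroot G i \<in> roots G"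
  using datum by (auto simp: split_reductive_sc_def root_base_def)

lemma pairing_root_coroot: "a \<in> roots G \<Longrightarrow> pairing a (coroot G a) = 2"
  using datum by (auto simp: split_reductive_sc_def reduced_root_datum_def)

lemma wt_cr: "j \<in> I \<Longrightarrow> wt i \<bullet> cr j = (if i = j then 1 else 0)"
proof (cases "i \<in> I")
  case True
  then show "j \<in> I \<Longrightarrow> ?thesis"
    using weights by (simp add: extended_weights_def rvec_inner)
next
  case False
  assume j: "j \<in> I"
  have "\<omega> i \<in> chars_D G"
    using weights False by (auto simp: extended_weights_def)
  then have "pairing (\<omega> i) (scoroot G j) = 0"
    using sroot_in_roots[OF j] by (simp add: chars_D_def scoroot_def)
  then show ?thesis using False j by (auto simp: rvec_inner)
qed

text \<open>
  Pairing an integral relation among the \<open>\<omega> i\<close> with the simple coroots kills its coefficients in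
  \<open>I\<close>, and the remaining \<open>\<omega> i\<close> are independent by hypothesis.
\<close>

lemma det_weights: "det (\<chi> i. \<omega> i) \<noteq> 0"
proof (rule det_nonzero_of_int_independent_rows)
  fix m assume "(\<Sum>i\<in>UNIV. m i *s (\<chi> i. \<omega> i) $ i) = 0"
  then have rel: "(\<Sum>i\<in>UNIV. m i *s \<omega> i) = 0" by simp
  have mI: "m j = 0" if "j \<in> I" for j
  proof -
    have "pairing (\<omega> i) (scoroot G j) = of_bool (i = j)" for i
    proof -
      have "real_of_int (pairing (\<omega> i) (scoroot G j)) = (if i = j then 1 else 0)"
        using wt_cr[OF that, of i] by (simp add: rvec_inner)
      then show ?thesis by (auto split: if_splits)
    qed
    then have "pairing (\<Sum>i\<in>UNIV. m i *s \<omega> i) (scoroot G j) = m j"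
      by (simp only: pairing_sum_left) simp
    then show ?thesis by (simp add: rel pairing_def)
  qed
  have "(\<Sum>i\<in>- I. m i *s \<omega> i) = (\<Sum>i\<in>UNIV. m i *s \<omega> i)"
    by (rule sum.mono_neutral_left) (auto simp: mI)
  then have "\<forall>i\<in>- I. m i = 0"
    using weights rel by (simp add: extended_weights_def)
  with mI show "\<forall>i. m i = 0" by blast
qed

lemma eq_0_of_weights: "(\<And>i. wt i \<bullet> x = 0) \<Longrightarrow> x = 0"
  by (rule rmat_inj[OF det_weights]) (simp add: vec_eq_iff rmat_mult_nth)

lemma obtain_of_weights:
  obtains x where "\<And>i. wt i \<bullet> x = b i"
proof -
  obtain x where "rmat (\<chi> i. \<omega> i) *v x = (\<chi> i. b i)" by (rule rmat_surj[OF det_weights])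
  then have "wt i \<bullet> x = b i" for i
    using rmat_mult_nth[of "\<chi> i. \<omega> i" x i] by simp
  then show thesis by (rule that)
qed

lemma eq_of_weights: "(\<And>i. wt i \<bullet> x = wt i \<bullet> y) \<Longrightarrow> x = y"
  using eq_0_of_weights[of "x - y"] by (simp add: inner_diff_right)

lemma wt_sum_cr:
  "wt i \<bullet> (\<Sum>j\<in>I. c j *\<^sub>R cr j) = (if i \<in> I then c i else 0)"
  by (simp add: inner_sum_right wt_cr if_distrib cong: if_cong sum.cong)

text \<open>
  The coefficients of a combination of simple coroots are its coordinates \<open>\<langle>\<omega>\<^sub>i, x\<rangle>\<close>, which turns the
  order \<open>\<le>\<close> into a comparison of coordinates.
\<close>

lemma coroot_expansion:
  assumes "\<And>j. j \<notin> I \<Longrightarrow> wt j \<bullet> x = 0"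
  shows "x = (\<Sum>i\<in>I. (wt i \<bullet> x) *\<^sub>R cr i)"
  by (rule eq_of_weights) (simp add: wt_sum_cr assms)

lemma dom_le_iff:
  "dom_le G x y \<longleftrightarrow> (\<forall>i\<in>I. wt i \<bullet> x \<le> wt i \<bullet> y) \<and> (\<forall>j\<in>- I. wt j \<bullet> x = wt j \<bullet> y)"
proof
  assume "dom_le G x y"
  then obtain c where c: "\<forall>i\<in>I. 0 \<le> c i" "y - x = (\<Sum>i\<in>I. c i *\<^sub>R cr i)"
    by (auto simp: dom_le_def)
  have "wt i \<bullet> y - wt i \<bullet> x = (if i \<in> I then c i else 0)" for i
    using wt_sum_cr[of i c] c(2) by (metis inner_diff_right)
  then show "(\<forall>i\<in>I. wt i \<bullet> x \<le> wt i \<bullet> y) \<and> (\<forall>j\<in>- I. wt j \<bullet> x = wt j \<bullet> y)"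
    using c(1) by (metis ComplD diff_ge_0_iff_ge eq_iff_diff_eq_0)
next
  assume "(\<forall>i\<in>I. wt i \<bullet> x \<le> wt i \<bullet> y) \<and> (\<forall>j\<in>- I. wt j \<bullet> x = wt j \<bullet> y)"
  then have "\<And>j. j \<notin> I \<Longrightarrow> wt j \<bullet> (y - x) = 0"
      and "\<forall>i\<in>I. 0 \<le> wt i \<bullet> (y - x)"
    by (simp_all add: inner_diff_right)
  with coroot_expansion[of "y - x"] show "dom_le G x y"
    unfolding dom_le_def by (intro exI[of _ "\<lambda>i. wt i \<bullet> (y - x)"]) simp
qed

lemma a_dom_iff: "x \<in> a_dom G \<longleftrightarrow> (\<forall>i\<in>I. 0 \<le> rt i \<bullet> x)"
  by (simp add: a_dom_def pairing_eq_inner)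

lemma bilinear_ip: "bilinear ip"
  using inner by (simp add: weyl_inner_def)

lemma ip_commute: "ip x y = ip y x"
  using inner by (simp add: weyl_inner_def)

lemma ip_pos: "x \<noteq> 0 \<Longrightarrow> 0 < ip x x"
  using inner by (simp add: weyl_inner_def)

lemmas ip_simps =
  bilinear_ladd[OF bilinear_ip] bilinear_radd[OF bilinear_ip]
  bilinear_lsub[OF bilinear_ip] bilinear_rsub[OF bilinear_ip]
  bilinear_lmul[OF bilinear_ip] bilinear_rmul[OF bilinear_ip]
  bilinear_lzero[OF bilinear_ip] bilinear_rzero[OF bilinear_ip]
  bilinear_lneg[OF bilinear_ip] bilinear_rneg[OF bilinear_ip]

lemma ip_nonneg: "0 \<le> ip x x"
  using ip_pos[of x] by (cases "x = 0") (auto simp: ip_simps)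

lemma ip_sum_left: "ip (\<Sum>i\<in>S. c i *\<^sub>R v i) x = (\<Sum>i\<in>S. c i * ip (v i) x)"
  by (induction S rule: infinite_finite_induct) (auto simp: ip_simps)

text \<open>
  The reflection in \<open>\<alpha>\<^sub>i\<close> is an isometry that negates \<open>\<alpha>\<^sub>i\<^sup>\<or>\<close>, so that
  \<open>\<langle>\<alpha>\<^sub>i, x\<rangle> = 2 (\<alpha>\<^sub>i\<^sup>\<or>, x) / (\<alpha>\<^sub>i\<^sup>\<or>, \<alpha>\<^sub>i\<^sup>\<or>)\<close>: the inner product carries simple coroots to positive
  multiples of simple roots.
\<close>

lemma ip_cr:
  assumes "i \<in> I"
  shows "2 * ip (cr i) x = (rt i \<bullet> x) * ip (cr i) (cr i)"
proof -
  let ?s = "cochar_refl (rt i) (cr i)"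
  note i = sroot_in_roots[OF assms]
  have "?s \<circ> id \<in> weyl_a G"
    unfolding weyl_a_def
    by (rule gen_by.gen_step[OF _ gen_by.gen_id]) (use i in \<open>auto simp: scoroot_def\<close>)
  then have "ip (?s (cr i)) (?s x) = ip (cr i) x"
    using inner by (simp add: weyl_inner_def)
  moreover have "?s x = x - (rt i \<bullet> x) *\<^sub>R cr i" for x
    by (simp add: cochar_refl_def pairing_eq_inner scalar_mult_eq_scaleR)
  moreover have "rt i \<bullet> cr i = 2"
    using pairing_root_coroot[OF i] by (simp add: rvec_inner scoroot_def)
  ultimately show ?thesis by (simp add: ip_simps)
qed

lemma ip_cr_pos: "i \<in> I \<Longrightarrow> 0 < ip (cr i) (cr i)"
  using wt_cr[of i i] by (intro ip_pos) auto

text \<open>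
  The reflection of \<open>\<alpha>\<^sub>i\<close> in \<open>\<alpha>\<^sub>j\<close> is a root whose coefficient at \<open>\<alpha>\<^sub>i\<close> is \<open>1\<close>; hence its coefficient
  \<open>- \<langle>\<alpha>\<^sub>i, \<alpha>\<^sub>j\<^sup>\<or>\<rangle>\<close> at \<open>\<alpha>\<^sub>j\<close> is not negative either.
\<close>

lemma rt_cr_nonpos:
  assumes "i \<in> I" "j \<in> I" "i \<noteq> j"
  shows "rt i \<bullet> cr j \<le> 0"
proof -
  define p where "p = pairing (sroot G i) (scoroot G j)"
  let ?a = "char_refl (sroot G j) (coroot G (sroot G j)) (sroot G i)"
  have "?a \<in> roots G"
    using datum sroot_in_roots[OF assms(1)] sroot_in_roots[OF assms(2)]
    by (auto simp: split_reductive_sc_def reduced_root_datum_def)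
  moreover have a: "?a = sroot G i - p *s sroot G j"
    by (simp add: char_refl_def p_def scoroot_def)
  ultimately obtain m where m: "sroot G i - p *s sroot G j = (\<Sum>k\<in>I. m k *s sroot G k)"
      "(\<forall>k\<in>I. 0 \<le> m k) \<or> (\<forall>k\<in>I. m k \<le> 0)"
    using datum by (auto simp: split_reductive_sc_def root_base_def)
  have "(\<Sum>k\<in>I. (m k - (if k = i then 1 else 0) + (if k = j then p else 0)) *s sroot G k)
      = (\<Sum>k\<in>I. m k *s sroot G k) - (\<Sum>k\<in>I. (if k = i then 1 else 0) *s sroot G k)
        + (\<Sum>k\<in>I. (if k = j then p else 0) *s sroot G k)"
    by (simp add: vector_sub_rdistrib vector_sadd_rdistrib sum.distrib sum_subtractf)
  also have "\<dots> = 0"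
    using assms by (simp add: m(1)[symmetric] if_distrib[of "\<lambda>c. c *s _"] cong: if_cong)
  finally have
    "(\<Sum>k\<in>I. (m k - (if k = i then 1 else 0) + (if k = j then p else 0)) *s sroot G k) = 0" .
  moreover have "\<forall>m. (\<Sum>k\<in>I. m k *s sroot G k) = 0 \<longrightarrow> (\<forall>k\<in>I. m k = 0)"
    using datum by (simp add: split_reductive_sc_def root_base_def)
  ultimately have z: "\<forall>k\<in>I. m k - (if k = i then 1 else 0) + (if k = j then p else 0) = 0"
    by (elim allE impE)
  have "m i = 1" "m j = - p"
    using bspec[OF z assms(1)] bspec[OF z assms(2)] assms(3) by simp_all
  with m(2) assms have "p \<le> 0" by fastforce
  then show ?thesis by (simp add: rvec_inner p_def)
qed

text \<open>
  With \<open>b i = \<langle>\<omega>\<^sub>i, u\<rangle>\<close>, the vector \<open>v\<close> below is the negative part of \<open>u = \<Sum> b\<^sub>i \<alpha>\<^sub>i\<^sup>\<or>\<close>.  Since distinct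
  simple coroots make obtuse angles, \<open>(v, u) \<le> - (v, v)\<close>, whereas the hypothesis gives
  \<open>(v, u) \<ge> 0\<close>.
\<close>

lemma weights_nonneg:
  assumes D: "\<And>j. j \<notin> I \<Longrightarrow> wt j \<bullet> u = 0"
    and neg: "\<And>i. i \<in> I \<Longrightarrow> wt i \<bullet> u < 0 \<Longrightarrow> 0 \<le> rt i \<bullet> u"
    and "i \<in> I"
  shows "0 \<le> wt i \<bullet> u"
proof -
  define m where "m i = max 0 (- (wt i \<bullet> u))" for i
  define v where "v = (\<Sum>i\<in>I. m i *\<^sub>R cr i)"
  define w where "w = (\<Sum>i\<in>I. max 0 (wt i \<bullet> u) *\<^sub>R cr i)"
  have "u = (\<Sum>i\<in>I. (max 0 (wt i \<bullet> u) - m i) *\<^sub>R cr i)"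
    by (subst coroot_expansion[of u, OF D]) (auto intro!: sum.cong simp: m_def max_def)
  then have u: "u = w - v"
    by (simp add: w_def v_def scaleR_left_diff_distrib sum_subtractf)
  have sgn: "0 \<le> ip (cr i) x \<longleftrightarrow> 0 \<le> rt i \<bullet> x" if "i \<in> I" for i x
  proof -
    have "0 \<le> 2 * ip (cr i) x \<longleftrightarrow> 0 \<le> rt i \<bullet> x"
      unfolding ip_cr[OF that, of x] using ip_cr_pos[OF that] by (simp add: zero_le_mult_iff)
    then show ?thesis by simp
  qed
  have "0 \<le> ip v u"
    unfolding v_def ip_sum_left
  proof (rule sum_nonneg)
    fix i assume i: "i \<in> I"
    show "0 \<le> m i * ip (cr i) u"
      using neg[OF i] sgn[OF i, of u]
      by (cases "wt i \<bullet> u < 0") (auto simp: m_def max_def mult_nonpos_nonneg)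
  qed
  moreover have "ip v w \<le> 0"
  proof -
    have le: "m i * (max 0 (wt j \<bullet> u) * ip (cr j) (cr i)) \<le> 0" if ij: "i \<in> I" "j \<in> I" for i j
    proof (cases "i = j")
      case True
      then show ?thesis by (simp add: m_def max_def)
    next
      case False
      have "ip (cr j) (cr i) \<le> 0"
      proof -
        have "2 * ip (cr j) (cr i) \<le> 0"
          unfolding ip_cr[OF ij(2), of "cr i"] using ip_cr_pos[OF ij(2)] rt_cr_nonpos[of j i] ij False
          by (intro mult_nonpos_nonneg) auto
        then show ?thesis by simp
      qed
      then show ?thesis
        by (intro mult_nonneg_nonpos) (auto simp: m_def)
    qed
    have "ip v w = (\<Sum>i\<in>I. m i * (\<Sum>j\<in>I. max 0 (wt j \<bullet> u) * ip (cr j) (cr i)))"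
      unfolding v_def ip_sum_left
      by (subst ip_commute) (simp add: w_def ip_sum_left)
    also have "\<dots> = (\<Sum>i\<in>I. \<Sum>j\<in>I. m i * (max 0 (wt j \<bullet> u) * ip (cr j) (cr i)))"
      by (simp add: sum_distrib_left)
    also have "\<dots> \<le> 0" by (intro sum_nonpos le)
    finally show ?thesis .
  qed
  ultimately have "ip v v \<le> 0" by (simp add: u ip_simps)
  then have "v = 0" using ip_pos[of v] by force
  then have "wt i \<bullet> v = 0" by simp
  then have "m i = 0" using \<open>i \<in> I\<close> by (simp add: v_def wt_sum_cr)
  then show ?thesis by (simp add: m_def)
qed

definition mixed_matrix :: "int ^ 'n ^ 'n" where
  "mixed_matrix = (\<chi> i. if i \<in> I then sroot G i else \<omega> i)"

text \<open>
  A vector on which the simple roots and the characters of \<open>D\<close> vanish is a combination of simple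
  coroots orthogonal to all simple coroots, hence zero.  So the roots \<open>\<alpha>\<^sub>i\<close> together with a basis of \<open>X\<^sup>*(D)\<close> are
  coordinates on \<open>\<aa>\<close> as well; this is the decomposition of \<open>\<aa>\<close> into \<open>\<aa>\<^sub>G\<close> and the span of the coroots.
\<close>

lemma det_mixed_matrix: "det mixed_matrix \<noteq> 0"
proof -
  have "x = 0" if x: "rmat mixed_matrix *v x = 0" for x
  proof -
    have x': "rvec (mixed_matrix $ i) \<bullet> x = 0" for i
      using x by (simp add: rmat_mult_nth[symmetric])
    have wt: "wt j \<bullet> x = 0" if "j \<notin> I" for j
      using x'[of j] that by (simp add: mixed_matrix_def)
    have "ip (cr i) x = 0" if "i \<in> I" for i
      using x'[of i] ip_cr[OF that, of x] that by (simp add: mixed_matrix_def)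
    then have "ip (\<Sum>i\<in>I. (wt i \<bullet> x) *\<^sub>R cr i) x = 0"
      by (simp add: ip_sum_left)
    then have "ip x x = 0" using coroot_expansion[OF wt] by simp
    then show "x = 0" using ip_pos[of x] by force
  qed
  then have "invertible (rmat mixed_matrix)"
    using invertible_left_inverse matrix_left_invertible_ker by blast
  then show ?thesis by (simp add: invertible_det_nz det_rmat)
qed

lemma mixed_injective:
  assumes "\<And>i. i \<in> I \<Longrightarrow> rt i \<bullet> x = rt i \<bullet> y" "\<And>j. j \<notin> I \<Longrightarrow> wt j \<bullet> x = wt j \<bullet> y"
  shows "x = y"
proof -
  have "x - y = 0"
    by (rule rmat_inj[OF det_mixed_matrix])
      (use assms in \<open>auto simp: vec_eq_iff rmat_mult_nth mixed_matrix_def inner_diff_right\<close>)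
  then show ?thesis by simp
qed

lemma obtain_mixed:
  obtains x where "\<And>i. i \<in> I \<Longrightarrow> rt i \<bullet> x = b i" "\<And>j. j \<notin> I \<Longrightarrow> wt j \<bullet> x = b j"
proof -
  obtain x where x: "rmat mixed_matrix *v x = (\<chi> i. b i)" by (rule rmat_surj[OF det_mixed_matrix])
  have eq: "rvec (mixed_matrix $ i) \<bullet> x = b i" for i
    using x by (simp add: rmat_mult_nth[symmetric])
  show thesis
  proof (rule that)
    show "rt i \<bullet> x = b i" if "i \<in> I" for i using eq[of i] that by (simp add: mixed_matrix_def)
    show "wt i \<bullet> x = b i" if "i \<notin> I" for i using eq[of i] that by (simp add: mixed_matrix_def)
  qed
qed

section \<open>The retraction onto the dominant cone\<close>

lemma ip_bounds:
  obtains m B where "0 < m" "0 < B" "\<And>x. m * (norm x)\<^sup>2 \<le> ip x x"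
    "\<And>x y. ip x y \<le> B * norm x * norm y"
proof -
  have bb: "bounded_bilinear ip"
    using bilinear_ip bilinear_conv_bounded_bilinear by blast
  obtain B where B: "0 < B" "\<And>x y. norm (ip x y) \<le> B * norm x * norm y"
    using bilinear_bounded_pos[OF bilinear_ip] by blast
  have "continuous_on (sphere 0 1) (\<lambda>x. ip x x)"
    using bb by (intro bounded_bilinear.continuous_on[OF bb] continuous_on_id)
  moreover have "sphere (0 :: real ^ 'n) 1 \<noteq> {}" by simp
  ultimately obtain e where e: "e \<in> sphere 0 1" "\<And>x. x \<in> sphere 0 1 \<Longrightarrow> ip e e \<le> ip x x"
    using continuous_attains_inf[OF compact_sphere] by blast
  show thesis
  proof (rule that[of "ip e e" B])
    show "0 < ip e e" using e(1) by (intro ip_pos) auto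
    show "ip e e * (norm x)\<^sup>2 \<le> ip x x" for x
    proof (cases "x = 0")
      case False
      then have "ip e e \<le> ip (x /\<^sub>R norm x) (x /\<^sub>R norm x)" by (intro e(2)) simp
      also have "\<dots> = ip x x / (norm x)\<^sup>2"
        by (simp add: ip_simps power2_eq_square divide_inverse)
      finally show ?thesis using False by (simp add: field_simps)
    qed (simp add: ip_simps)
    show "ip x y \<le> B * norm x * norm y" for x y
      using B(2)[of x y] by simp
  qed (rule B(1))
qed

lemma closed_a_dom: "closed (a_dom G)"
proof -
  have "a_dom G = (\<Inter>i\<in>I. {x. 0 \<le> rt i \<bullet> x})" by (auto simp: a_dom_iff)
  then show ?thesis by (simp add: closed_INT closed_Collect_le continuous_intros)
qed

lemma a_dom_cone:
  assumes "x \<in> a_dom G" "y \<in> a_dom G" "0 \<le> s" "0 \<le> t"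
  shows "s *\<^sub>R x + t *\<^sub>R y \<in> a_dom G"
  using assms by (simp add: a_dom_iff inner_add_right)

lemma nearest_exists:
  obtains y where "y \<in> a_dom G" "\<And>z. z \<in> a_dom G \<Longrightarrow> ip (x - y) (x - y) \<le> ip (x - z) (x - z)"
proof -
  obtain m where m: "0 < m" "\<And>x. m * (norm x)\<^sup>2 \<le> ip x x" by (rule ip_bounds) (rule that)
  define R where "R = sqrt (ip x x / m)"
  let ?K = "a_dom G \<inter> cball x R"
  have bb: "bounded_bilinear ip"
    using bilinear_ip bilinear_conv_bounded_bilinear by blast
  have "norm x \<le> R"
    unfolding R_def using m(1) m(2)[of x] by (intro real_le_rsqrt) (simp add: field_simps)
  then have "0 \<in> ?K" by (simp add: a_dom_iff)
  moreover have "compact ?K" using closed_a_dom by (intro closed_Int_compact) auto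
  moreover have "continuous_on ?K (\<lambda>z. ip (x - z) (x - z))"
    by (intro bounded_bilinear.continuous_on[OF bb] continuous_intros)
  ultimately obtain y where y: "y \<in> ?K" "\<And>z. z \<in> ?K \<Longrightarrow> ip (x - y) (x - y) \<le> ip (x - z) (x - z)"
    using continuous_attains_inf[of ?K] by blast
  show thesis
  proof (rule that)
    show "y \<in> a_dom G" using y(1) by simp
    fix z assume z: "z \<in> a_dom G"
    show "ip (x - y) (x - y) \<le> ip (x - z) (x - z)"
    proof (cases "dist x z \<le> R")
      case True
      then show ?thesis using y(2) z by simp
    next
      case False
      have "ip x x = m * R\<^sup>2" using m(1) ip_nonneg[of x] by (simp add: R_def)
      also have "\<dots> \<le> m * (norm (x - z))\<^sup>2"
        using False m(1) order_trans[OF norm_ge_zero \<open>norm x \<le> R\<close>]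
        by (intro mult_left_mono power_mono) (auto simp: dist_norm)
      also have "\<dots> \<le> ip (x - z) (x - z)" by (rule m(2))
      finally show ?thesis using y(2)[of 0] \<open>0 \<in> ?K\<close> by simp
    qed
  qed
qed

text \<open>
  Moving from a nearest point \<open>y\<close> a little towards \<open>z\<close> stays in the cone and changes the squared
  distance, to first order, by \<open>- 2 (x - y, z - y)\<close>.
\<close>

lemma nearest_variational:
  assumes y: "y \<in> a_dom G" "\<And>z. z \<in> a_dom G \<Longrightarrow> ip (x - y) (x - y) \<le> ip (x - z) (x - z)"
    and z: "z \<in> a_dom G"
  shows "ip (x - y) (z - y) \<le> 0"
proof (rule ccontr)
  define p q where "p = ip (x - y) (z - y)" and "q = ip (z - y) (z - y)"
  assume "\<not> ip (x - y) (z - y) \<le> 0"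
  then have p: "0 < p" by (simp add: p_def)
  have q: "0 \<le> q" by (simp add: q_def ip_nonneg)
  define t where "t = min 1 (p / (q + 1))"
  have t: "0 < t" "t \<le> 1" "t * q \<le> p"
  proof -
    show "0 < t" "t \<le> 1" using p q by (auto simp: t_def)
    have "t * q \<le> p / (q + 1) * q" using q by (intro mult_right_mono) (auto simp: t_def)
    also have "\<dots> \<le> p" using p q by (simp add: field_simps)
    finally show "t * q \<le> p" .
  qed
  have "y + t *\<^sub>R (z - y) = (1 - t) *\<^sub>R y + t *\<^sub>R z" by (simp add: algebra_simps)
  then have "y + t *\<^sub>R (z - y) \<in> a_dom G" using a_dom_cone[OF y(1) z, of "1 - t" t] t by simp
  then have "ip (x - y) (x - y) \<le> ip (x - y - t *\<^sub>R (z - y)) (x - y - t *\<^sub>R (z - y))"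
    using y(2) by (simp add: diff_diff_eq)
  also have "\<dots> = ip (x - y) (x - y) - 2 * t * p + t * (t * q)"
  proof -
    have "ip (a - t *\<^sub>R b) (a - t *\<^sub>R b) = ip a a - 2 * t * ip a b + t * (t * ip b b)" for a b
      by (simp add: ip_simps ip_commute[of b a] algebra_simps)
    then show ?thesis unfolding p_def q_def .
  qed
  finally have "t * (2 * p) \<le> t * (t * q)" by simp
  then have "2 * p \<le> t * q" using t(1) by simp
  with t(3) p show False by simp
qed

text \<open>
  Add the two variational inequalities, tested on each other's nearest point.
  With \<open>x = x'\<close> this is uniqueness of the nearest point, and in general it makes the
  projection Lipschitz.
\<close>

lemma nearest_contraction:
  assumes y: "y \<in> a_dom G" "\<And>z. z \<in> a_dom G \<Longrightarrow> ip (x - y) (z - y) \<le> 0"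
    and y': "y' \<in> a_dom G" "\<And>z. z \<in> a_dom G \<Longrightarrow> ip (x' - y') (z - y') \<le> 0"
  shows "ip (y - y') (y - y') \<le> ip (x - x') (y - y')"
proof -
  have "ip (x - y) (y' - y) + ip (x' - y') (y - y') \<le> 0"
    using y(2)[OF y'(1)] y'(2)[OF y(1)] by simp
  then show ?thesis
    by (simp add: ip_simps ip_commute)
qed

lemma retr_properties:
  shows retr_dom: "retr G ip x \<in> a_dom G"
    and retr_variational: "z \<in> a_dom G \<Longrightarrow> ip (x - retr G ip x) (z - retr G ip x) \<le> 0"
proof -
  let ?P = "\<lambda>y. y \<in> a_dom G \<and> (\<forall>z\<in>a_dom G. ip (x - y) (x - y) \<le> ip (x - z) (x - z))"
  obtain y where y: "?P y" using nearest_exists[of x] by metis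
  have "y' = y" if y': "?P y'" for y'
  proof -
    have "ip (y' - y) (y' - y) \<le> ip (x - x) (y' - y)"
      using y y' by (intro nearest_contraction nearest_variational) auto
    then show ?thesis using ip_pos[of "y' - y"] by (force simp: ip_simps)
  qed
  with y have "?P (retr G ip x)"
    unfolding retr_def by (intro theI[of ?P y]) blast+
  then show "retr G ip x \<in> a_dom G"
    and "z \<in> a_dom G \<Longrightarrow> ip (x - retr G ip x) (z - retr G ip x) \<le> 0"
    using nearest_variational by blast+
qed

lemma continuous_retr: "continuous_on UNIV (retr G ip)"
proof -
  obtain m B where b: "0 < m" "0 < B" "\<And>x. m * (norm x)\<^sup>2 \<le> ip x x"
    "\<And>x y. ip x y \<le> B * norm x * norm y" by (rule ip_bounds) (rule that)
  have "(B / m)-lipschitz_on UNIV (retr G ip)"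
  proof (rule lipschitz_onI)
    fix x x' :: "real ^ 'n"
    define e where "e = retr G ip x - retr G ip x'"
    have "m * (norm e)\<^sup>2 \<le> ip e e" by (rule b(3))
    also have "\<dots> \<le> ip (x - x') e"
      unfolding e_def by (intro nearest_contraction retr_dom retr_variational)
    also have "\<dots> \<le> B * norm (x - x') * norm e" by (rule b(4))
    finally have "m * norm e \<le> B * norm (x - x')"
      using b(2) by (cases "e = 0") (auto simp: power2_eq_square)
    then show "dist (retr G ip x) (retr G ip x') \<le> B / m * dist x x'"
      using b(1) by (simp add: dist_norm e_def field_simps)
  qed (use b in auto)
  then show ?thesis by (rule lipschitz_on_continuous_on)
qed

text \<open>
  Testing the variational inequality on \<open>r x + z\<close> for dominant \<open>z\<close>, and on \<open>0\<close> and \<open>2 r x\<close>.  The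
  vectors \<open>\<plusminus> z\<close> with \<open>z \<in> \<aa>\<^sub>G\<close> show that \<open>r x - x\<close> is a combination of simple coroots; the vectors dual
  to the simple roots show that its coefficients are not negative; and orthogonality to \<open>r x\<close>
  gives complementary slackness.
\<close>

lemma retr_weights:
  shows retr_wt_eq: "j \<notin> I \<Longrightarrow> wt j \<bullet> retr G ip x = wt j \<bullet> x"
    and retr_wt_ge: "i \<in> I \<Longrightarrow> wt i \<bullet> x \<le> wt i \<bullet> retr G ip x"
    and retr_slack: "i \<in> I \<Longrightarrow> wt i \<bullet> x < wt i \<bullet> retr G ip x \<Longrightarrow> rt i \<bullet> retr G ip x = 0"
proof -
  define y where "y = retr G ip x"
  define d where "d = x - y"
  have ydom: "y \<in> a_dom G" by (simp add: y_def retr_dom)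
  have var: "ip d (z - y) \<le> 0" if "z \<in> a_dom G" for z
    using that by (simp add: d_def y_def retr_variational)
  have polar: "ip d z \<le> 0" if "z \<in> a_dom G" for z
    using var[of "y + z"] that ydom by (simp add: a_dom_iff inner_add_right)
  have "ip d y = 0"
    using var[of 0] polar[OF ydom] by (simp add: a_dom_iff ip_simps)
  obtain g where g: "\<And>i. i \<in> I \<Longrightarrow> rt i \<bullet> g = 0" "\<And>j. j \<notin> I \<Longrightarrow> wt j \<bullet> g = wt j \<bullet> d"
    using obtain_mixed[of "\<lambda>i. if i \<in> I then 0 else wt i \<bullet> d"] by auto
  have "wt j \<bullet> (d - g) = 0" if "j \<notin> I" for j
    using that by (simp add: inner_diff_right g(2))
  note expansion = coroot_expansion[OF this]
  have "ip (cr i) g = 0" if "i \<in> I" for i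
    using ip_cr[OF that, of g] g(1)[OF that] by simp
  then have "ip (d - g) g = 0"
    by (subst expansion) (simp_all add: ip_sum_left)
  moreover have "ip d g = 0"
    using polar[of g] polar[of "- g"] g(1) by (simp add: a_dom_iff ip_simps)
  ultimately have "ip g g = 0" by (simp add: ip_simps)
  then have "g = 0" using ip_pos[of g] by force
  then have D: "wt j \<bullet> d = 0" if "j \<notin> I" for j
    using g(2)[OF that] by simp
  then show "j \<notin> I \<Longrightarrow> wt j \<bullet> retr G ip x = wt j \<bullet> x" for j
    by (simp add: d_def y_def inner_diff_right)
  have ip_d: "2 * ip d z = (\<Sum>i\<in>I. (wt i \<bullet> d) * ((rt i \<bullet> z) * ip (cr i) (cr i)))" for z
  proof -
    have "2 * ip d z = 2 * (\<Sum>i\<in>I. (wt i \<bullet> d) * ip (cr i) z)"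
      by (subst coroot_expansion[OF D]) (simp_all add: ip_sum_left)
    also have "\<dots> = (\<Sum>i\<in>I. (wt i \<bullet> d) * (2 * ip (cr i) z))"
      by (simp add: sum_distrib_left mult_ac)
    finally show ?thesis by (simp add: ip_cr cong: sum.cong)
  qed
  have le: "wt i \<bullet> d \<le> 0" if i: "i \<in> I" for i
  proof -
    obtain z where z: "\<And>k. k \<in> I \<Longrightarrow> rt k \<bullet> z = of_bool (k = i)"
      using obtain_mixed[of "\<lambda>k. of_bool (k = i)"] by metis
    have "2 * ip d z = (\<Sum>k\<in>I. if k = i then (wt k \<bullet> d) * ip (cr k) (cr k) else 0)"
      unfolding ip_d by (rule sum.cong) (auto simp: z)
    then have "2 * ip d z = (wt i \<bullet> d) * ip (cr i) (cr i)"
      using i by simp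
    moreover have "ip d z \<le> 0" by (rule polar) (simp add: a_dom_iff z)
    ultimately have "(wt i \<bullet> d) * ip (cr i) (cr i) \<le> 0" by simp
    then show ?thesis using ip_cr_pos[OF i] by (simp add: mult_le_0_iff)
  qed
  then show "i \<in> I \<Longrightarrow> wt i \<bullet> x \<le> wt i \<bullet> retr G ip x" for i
    by (simp add: d_def y_def inner_diff_right)
  assume i: "i \<in> I" and lt: "wt i \<bullet> x < wt i \<bullet> retr G ip x"
  have nonpos: "(wt k \<bullet> d) * ((rt k \<bullet> y) * ip (cr k) (cr k)) \<le> 0" if "k \<in> I" for k
    using le[OF that] ydom that ip_cr_pos[OF that]
    by (intro mult_nonpos_nonneg mult_nonneg_nonneg) (auto simp: a_dom_iff)
  have "(\<Sum>k\<in>I. - ((wt k \<bullet> d) * ((rt k \<bullet> y) * ip (cr k) (cr k)))) = 0"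
    using ip_d[of y] \<open>ip d y = 0\<close> by (simp add: sum_negf)
  then have "(wt i \<bullet> d) * ((rt i \<bullet> y) * ip (cr i) (cr i)) = 0"
    using i nonpos by (subst (asm) sum_nonneg_eq_0_iff) auto
  then show "rt i \<bullet> retr G ip x = 0"
    using lt ip_cr_pos[OF i] by (auto simp: d_def y_def inner_diff_right)
qed

lemma retr_ge: "dom_le G x (retr G ip x)"
  by (simp add: dom_le_iff retr_wt_eq retr_wt_ge)

lemma dom_le_trans: "dom_le G x y \<Longrightarrow> dom_le G y z \<Longrightarrow> dom_le G x z"
  unfolding dom_le_iff by (metis order_trans)

text \<open>
  If \<open>x \<le> b\<close>, a coordinate of \<open>b - r x\<close> can only be negative where \<open>x\<close> lies strictly below \<open>r x\<close>.  There
  \<open>r x\<close> is on the wall of \<open>\<alpha>\<^sub>i\<close>, so that \<open>b - r x\<close> pairs non-negatively with \<open>\<alpha>\<^sub>i\<close> and \<open>weights_nonneg\<close>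
  applies.
\<close>

lemma retr_le_iff:
  assumes "b \<in> a_dom G"
  shows "dom_le G (retr G ip x) b \<longleftrightarrow> dom_le G x b"
proof
  show "dom_le G (retr G ip x) b \<Longrightarrow> dom_le G x b" by (rule dom_le_trans[OF retr_ge])
next
  assume le: "dom_le G x b"
  define u where "u = b - retr G ip x"
  have "0 \<le> wt i \<bullet> u" if "i \<in> I" for i
  proof (rule weights_nonneg[OF _ _ that])
    show "wt j \<bullet> u = 0" if "j \<notin> I" for j
      using le that by (simp add: u_def inner_diff_right retr_wt_eq dom_le_iff)
    fix k assume k: "k \<in> I" and neg: "wt k \<bullet> u < 0"
    have "wt k \<bullet> x < wt k \<bullet> retr G ip x"
      using neg le k by (auto simp: u_def inner_diff_right dom_le_iff)
    then show "0 \<le> rt k \<bullet> u"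
      using retr_slack[OF k] assms k by (simp add: u_def inner_diff_right a_dom_iff)
  qed
  then show "dom_le G (retr G ip x) b"
    using le by (simp add: u_def dom_le_iff inner_diff_right retr_wt_eq)
qed

lemma retr_eq_of_same_dominant_bounds:
  assumes "\<And>b. b \<in> a_dom G \<Longrightarrow> dom_le G x b \<longleftrightarrow> dom_le G x' b"
  shows "retr G ip x = retr G ip x'"
proof (rule eq_of_weights)
  fix i
  have "dom_le G (retr G ip x) (retr G ip x')" "dom_le G (retr G ip x') (retr G ip x)"
    using assms retr_le_iff retr_dom retr_ge by blast+
  then show "wt i \<bullet> retr G ip x = wt i \<bullet> retr G ip x'"
    by (cases "i \<in> I") (auto simp: dom_le_iff intro: antisym)
qed

section \<open>Extension of the retraction to infinite coordinates\<close>

lemma obtain_central_basis: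
  obtains g where "\<And>i j. i \<in> I \<Longrightarrow> j \<notin> I \<Longrightarrow> rt i \<bullet> g j = 0"
    "\<And>j k. j \<notin> I \<Longrightarrow> k \<notin> I \<Longrightarrow> wt k \<bullet> g j = of_bool (k = j)"
    "\<And>j k. g j $ k \<in> \<rat>"
proof -
  have "\<exists>x. rmat mixed_matrix *v x = rvec (axis j 1)" for j
    by (rule rmat_surj[OF det_mixed_matrix]) blast
  then obtain g where g: "\<And>j. rmat mixed_matrix *v g j = rvec (axis j 1)" by metis
  have eq: "rvec (mixed_matrix $ i) \<bullet> g j = of_bool (i = j)" for i j
    unfolding rmat_mult_nth[symmetric] g by (simp add: rvec_def axis_def)
  show thesis
  proof (rule that[of g])
    show "rt i \<bullet> g j = 0" if "i \<in> I" "j \<notin> I" for i j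
      using eq[of i j] that by (auto simp: mixed_matrix_def)
    show "wt k \<bullet> g j = of_bool (k = j)" if "j \<notin> I" "k \<notin> I" for j k
      using eq[of k j] that by (simp add: mixed_matrix_def)
    show "g j $ k \<in> \<rat>" for j k
      by (rule rmat_solution_rational[OF det_mixed_matrix g])
  qed
qed

text \<open>
  The basis of \<open>\<aa>\<^sub>G\<close> dual to \<open>\<omega> j\<close>, \<open>j \<notin> I\<close>.  Rationality is part of the choice because \<open>\<varpi>\<^sub>i\<close>
  must be rational, and it is \<open>\<omega> i\<close> minus the combination of the \<open>\<omega> j\<close> with the same values on this
  basis.
\<close>

definition central :: "'n \<Rightarrow> real ^ 'n" where
  "central = (SOME g. (\<forall>i\<in>I. \<forall>j\<in>- I. rt i \<bullet> g j = 0) \<and>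
     (\<forall>j\<in>- I. \<forall>k\<in>- I. wt k \<bullet> g j = of_bool (k = j)) \<and> (\<forall>j k. g j $ k \<in> \<rat>))"

lemma central_properties:
  shows rt_central: "i \<in> I \<Longrightarrow> j \<notin> I \<Longrightarrow> rt i \<bullet> central j = 0"
    and wt_central: "j \<notin> I \<Longrightarrow> k \<notin> I \<Longrightarrow> wt k \<bullet> central j = of_bool (k = j)"
    and central_rational: "central j $ k \<in> \<rat>"
proof -
  have "\<exists>g. (\<forall>i\<in>I. \<forall>j\<in>- I. rt i \<bullet> g j = 0) \<and>
     (\<forall>j\<in>- I. \<forall>k\<in>- I. wt k \<bullet> g j = of_bool (k = j)) \<and> (\<forall>j k. g j $ k \<in> \<rat>)"
    by (rule obtain_central_basis) (metis ComplD)
  from someI_ex[OF this]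
  show "i \<in> I \<Longrightarrow> j \<notin> I \<Longrightarrow> rt i \<bullet> central j = 0"
    and "j \<notin> I \<Longrightarrow> k \<notin> I \<Longrightarrow> wt k \<bullet> central j = of_bool (k = j)"
    and "central j $ k \<in> \<rat>"
    unfolding central_def[symmetric] by auto
qed

lemma central_sum:
  shows "i \<in> I \<Longrightarrow> rt i \<bullet> (\<Sum>j\<in>- I. c j *\<^sub>R central j) = 0"
    and "k \<notin> I \<Longrightarrow> wt k \<bullet> (\<Sum>j\<in>- I. c j *\<^sub>R central j) = c k"
proof -
  show "i \<in> I \<Longrightarrow> rt i \<bullet> (\<Sum>j\<in>- I. c j *\<^sub>R central j) = 0"
    by (simp add: inner_sum_right rt_central)
  assume k: "k \<notin> I"
  have "wt k \<bullet> (\<Sum>j\<in>- I. c j *\<^sub>R central j) = (\<Sum>j\<in>- I. if j = k then c j else 0)"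
    unfolding inner_sum_right by (rule sum.cong) (use k in \<open>auto simp: wt_central\<close>)
  then show "wt k \<bullet> (\<Sum>j\<in>- I. c j *\<^sub>R central j) = c k" using k by simp
qed

text \<open>
  A dominant element lies above the element of \<open>\<aa>\<^sub>G\<close> with the same \<open>D\<close>-coordinates: the roots vanish on
  the latter, so that \<open>weights_nonneg\<close> applies to the difference.
\<close>

lemma central_weights_least:
  assumes "b \<in> a_dom G" and "\<And>i. i \<in> I \<Longrightarrow> rt i \<bullet> g = 0"
    and "\<And>j. j \<notin> I \<Longrightarrow> wt j \<bullet> g = wt j \<bullet> b" and "i \<in> I"
  shows "wt i \<bullet> g \<le> wt i \<bullet> b"
proof -
  have "0 \<le> wt i \<bullet> (b - g)"
    using assms by (intro weights_nonneg) (auto simp: inner_diff_right a_dom_iff)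
  then show ?thesis by (simp add: inner_diff_right)
qed

text \<open>
  The element of \<open>\<aa>\<^sub>G\<close> with the \<open>D\<close>-coordinates of \<open>d\<close>.
\<close>

definition corner :: "ereal ^ 'n \<Rightarrow> real ^ 'n" where
  "corner d = (\<Sum>j\<in>- I. real_of_ereal (d $ j) *\<^sub>R central j)"

definition dual_vec :: "'n \<Rightarrow> real ^ 'n" where
  "dual_vec = (SOME h. \<forall>i k. wt k \<bullet> h i = of_bool (k = i))"

lemma wt_dual_vec: "wt k \<bullet> dual_vec i = of_bool (k = i)"
proof -
  have "\<exists>x. \<forall>k. wt k \<bullet> x = of_bool (k = i)" for i
    by (rule obtain_of_weights[of "\<lambda>k. of_bool (k = i)"]) blast
  then have "\<exists>h. \<forall>i k. wt k \<bullet> h i = of_bool (k = i)" by metis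
  from someI_ex[OF this] show ?thesis unfolding dual_vec_def[symmetric] by blast
qed

definition of_coords :: "('n \<Rightarrow> real) \<Rightarrow> real ^ 'n" where
  "of_coords b = (\<Sum>i\<in>UNIV. b i *\<^sub>R dual_vec i)"

lemma wt_of_coords: "wt k \<bullet> of_coords b = b k"
  by (simp add: of_coords_def inner_sum_right wt_dual_vec)

text \<open>
  On the domain of the extension neither argument below is infinite: the maximum with a real
  number replaces \<open>-\<infinity>\<close>, and the \<open>D\<close>-coordinates are real.
\<close>

definition lift :: "ereal ^ 'n \<Rightarrow> real ^ 'n" where
  "lift d = of_coords (\<lambda>i. real_of_ereal
     (if i \<in> I then max (d $ i) (ereal (wt i \<bullet> corner d)) else d $ i))"

lemma ext_domain_finite:
  assumes "d \<in> ext_domain G"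
  shows "i \<in> I \<Longrightarrow> \<bar>max (d $ i) (ereal b)\<bar> \<noteq> \<infinity>" and "j \<notin> I \<Longrightarrow> \<bar>d $ j\<bar> \<noteq> \<infinity>"
proof -
  show "i \<in> I \<Longrightarrow> \<bar>max (d $ i) (ereal b)\<bar> \<noteq> \<infinity>"
    using assms by (cases "d $ i") (auto simp: ext_domain_def max_def)
  show "j \<notin> I \<Longrightarrow> \<bar>d $ j\<bar> \<noteq> \<infinity>"
    using assms by (cases "d $ j") (auto simp: ext_domain_def)
qed

lemma ereal_wt_lift:
  assumes "d \<in> ext_domain G"
  shows "ereal (wt i \<bullet> lift d) = (if i \<in> I then max (d $ i) (ereal (wt i \<bullet> corner d)) else d $ i)"
  using ext_domain_finite[OF assms] by (simp add: lift_def wt_of_coords ereal_real')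

text \<open>
  The bounds imposed by the corner hold automatically for a dominant \<open>b\<close> with the \<open>D\<close>-coordinates of
  \<open>d\<close>, so the lift has the same dominant upper bounds as \<open>d\<close> itself.
\<close>

lemma lift_le_iff:
  assumes d: "d \<in> ext_domain G" and b: "b \<in> a_dom G"
  shows "dom_le G (lift d) b \<longleftrightarrow>
    (\<forall>i\<in>I. d $ i \<le> ereal (wt i \<bullet> b)) \<and> (\<forall>j\<in>- I. d $ j = ereal (wt j \<bullet> b))"
proof -
  have eqs: "wt j \<bullet> lift d = wt j \<bullet> b \<longleftrightarrow> d $ j = ereal (wt j \<bullet> b)" if "j \<in> - I" for j
    using ereal_wt_lift[OF d, of j] that by (metis ComplD ereal.inject)
  have les: "wt i \<bullet> lift d \<le> wt i \<bullet> b \<longleftrightarrow> d $ i \<le> ereal (wt i \<bullet> b)"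
    if D: "\<forall>j\<in>- I. d $ j = ereal (wt j \<bullet> b)" and i: "i \<in> I" for i
  proof -
    have "wt i \<bullet> corner d \<le> wt i \<bullet> b"
    proof (rule central_weights_least[OF b _ _ i])
      show "wt j \<bullet> corner d = wt j \<bullet> b" if "j \<notin> I" for j
        using D that by (simp add: corner_def central_sum)
    qed (simp add: corner_def central_sum)
    moreover have "wt i \<bullet> lift d \<le> wt i \<bullet> b \<longleftrightarrow>
        max (d $ i) (ereal (wt i \<bullet> corner d)) \<le> ereal (wt i \<bullet> b)"
      using ereal_wt_lift[OF d, of i] i by (metis ereal_less_eq(3))
    ultimately show ?thesis by simp
  qed
  show ?thesis unfolding dom_le_iff using eqs les by blast
qed

lemma continuous_on_lift: "continuous_on (ext_domain G) lift"
proof -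
  have nth: "continuous_on (ext_domain G) (\<lambda>d. d $ i)" for i
    by (intro continuous_intros)
  have corner: "continuous_on (ext_domain G) corner"
    unfolding corner_def
    by (intro continuous_intros continuous_on_real_of_ereal nth) (auto dest: ext_domain_finite(2))
  have "continuous_on (ext_domain G) (\<lambda>d. real_of_ereal
      (if i \<in> I then max (d $ i) (ereal (wt i \<bullet> corner d)) else d $ i))" for i
  proof (rule continuous_on_real_of_ereal)
    show "continuous_on (ext_domain G)
        (\<lambda>d. if i \<in> I then max (d $ i) (ereal (wt i \<bullet> corner d)) else d $ i)"
      using nth[of i] by (cases "i \<in> I") (auto intro!: continuous_on_max continuous_intros corner)
  qed (use ext_domain_finite in auto)
  then show ?thesis
    unfolding lift_def of_coords_def by (intro continuous_intros)
qed

lemma a_coords_in_ext_domain: "a_coords \<omega> x \<in> ext_domain G"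
  by (simp add: ext_domain_def a_coords_def)

lemma retr_lift_a_coords: "retr G ip (lift (a_coords \<omega> x)) = retr G ip x"
proof (rule retr_eq_of_same_dominant_bounds)
  fix b assume "b \<in> a_dom G"
  from lift_le_iff[OF a_coords_in_ext_domain this]
  show "dom_le G (lift (a_coords \<omega> x)) b \<longleftrightarrow> dom_le G x b"
    by (simp add: dom_le_iff a_coords_def pairing_eq_inner)
qed

lemma a_coords_dense:
  assumes "d \<in> ext_domain G"
  obtains x :: "nat \<Rightarrow> real ^ 'n" where "(\<lambda>k. a_coords \<omega> (x k)) \<longlonglongrightarrow> d"
proof -
  define x where "x k = of_coords (\<lambda>i. if d $ i = - \<infinity> then - real k else real_of_ereal (d $ i))"
    for k :: nat
  have "(\<lambda>k. a_coords \<omega> (x k)) \<longlonglongrightarrow> d"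
  proof (rule vec_tendstoI)
    fix i
    have c: "a_coords \<omega> (x k) $ i =
        ereal (if d $ i = - \<infinity> then - real k else real_of_ereal (d $ i))" for k
      by (simp add: a_coords_def pairing_eq_inner x_def wt_of_coords)
    show "(\<lambda>k. a_coords \<omega> (x k) $ i) \<longlonglongrightarrow> d $ i"
    proof (cases "d $ i = - \<infinity>")
      case True
      have "(\<lambda>k. - ereal (real k)) \<longlonglongrightarrow> - \<infinity>"
        by (intro tendsto_uminus_ereal id_nat_ereal_tendsto_PInf[unfolded comp_def])
      then show ?thesis by (simp add: c True)
    next
      case False
      have "\<bar>d $ i\<bar> \<noteq> \<infinity>"
        using assms False by (cases "i \<in> I"; cases "d $ i") (auto simp: ext_domain_def)
      then show ?thesis by (simp add: c False ereal_real')
    qed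
  qed
  then show thesis by (rule that)
qed

text \<open>
  The composition of \<open>r\<close> with the lift is a continuous extension, so the chosen extension has the
  required properties; both agree on finite points, which are dense.
\<close>

lemma retr_ext_eq:
  assumes d: "d \<in> ext_domain G"
  shows "retr_ext G ip \<omega> d = retr G ip (lift d)"
proof -
  let ?P = "\<lambda>f. continuous_on (ext_domain G) f \<and> f ` ext_domain G \<subseteq> a_dom G \<and>
    (\<forall>x. f (a_coords \<omega> x) = retr G ip x)"
  have cont: "continuous_on (ext_domain G) (\<lambda>d. retr G ip (lift d))"
    by (rule continuous_on_compose2[OF continuous_retr continuous_on_lift]) simp
  then have "?P (\<lambda>d. retr G ip (lift d))"
    by (auto simp: retr_dom retr_lift_a_coords)
  then have P: "?P (retr_ext G ip \<omega>)"
    unfolding retr_ext_def by (rule someI[of ?P])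
  obtain x where x: "(\<lambda>k::nat. a_coords \<omega> (x k)) \<longlonglongrightarrow> d" by (rule a_coords_dense[OF d])
  have lim: "(\<lambda>k. f (a_coords \<omega> (x k))) \<longlonglongrightarrow> f d" if "continuous_on (ext_domain G) f"
    for f :: "ereal ^ 'n \<Rightarrow> real ^ 'n"
    by (rule continuous_on_tendsto_compose[OF that x d]) (simp add: a_coords_in_ext_domain)
  have "(\<lambda>k. retr_ext G ip \<omega> (a_coords \<omega> (x k))) \<longlonglongrightarrow> retr_ext G ip \<omega> d"
    using P by (intro lim) blast
  moreover have "(\<lambda>k. retr G ip (lift (a_coords \<omega> (x k)))) \<longlonglongrightarrow> retr G ip (lift d)"
    by (rule lim[OF cont])
  ultimately show ?thesis
    using P by (auto simp: retr_lift_a_coords intro: LIMSEQ_unique)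
qed

lemma retr_ext_le_iff:
  assumes "d \<in> ext_domain G" "b \<in> a_dom G"
  shows "dom_le G (retr_ext G ip \<omega> d) b \<longleftrightarrow>
    (\<forall>i\<in>I. d $ i \<le> ereal (wt i \<bullet> b)) \<and> (\<forall>j\<in>- I. d $ j = ereal (wt j \<bullet> b))"
  using assms by (simp add: retr_ext_eq retr_le_iff lift_le_iff)

section \<open>Fundamental weights\<close>

lemma a_M_iff: "x \<in> a_M G I \<longleftrightarrow> (\<forall>i\<in>I. rt i \<bullet> x = 0)"
  by (simp add: a_M_def pairing_eq_inner)

text \<open>
  The weight \<open>l\<close> below corrects \<open>\<omega> i\<close> by characters of \<open>D\<close>, which vanish on coroots, so that it
  vanishes on \<open>\<aa>\<^sub>G\<close>.  It is the only candidate since \<open>\<aa>\<^sub>G\<close> and the simple coroots span \<open>\<aa>\<close>.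
\<close>

lemma varpi_pairing_cr:
  assumes i: "i \<in> I"
  shows "j \<in> I \<Longrightarrow> varpi G i \<bullet> cr j = (if i = j then 1 else 0)"
proof -
  let ?P = "\<lambda>l. (\<forall>k. l $ k \<in> \<rat>) \<and>
     (\<forall>j\<in>I. pairing l (cr j) = (if i = j then 1 else 0)) \<and> (\<forall>x\<in>a_M G I. pairing l x = 0)"
  define l where "l = wt i - (\<Sum>j\<in>- I. (wt i \<bullet> central j) *\<^sub>R wt j)"
  have "?P l"
  proof (intro conjI ballI allI)
    fix k
    have "wt i \<bullet> central j \<in> \<rat>" for j
      by (auto simp: inner_vec_def rvec_def intro!: Rats_sum Rats_mult central_rational)
    then show "l $ k \<in> \<rat>"
      by (auto simp: l_def rvec_def sum_component intro!: Rats_diff Rats_sum Rats_mult)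
  next
    fix j assume j: "j \<in> I"
    then have "wt k \<bullet> cr j = 0" if "k \<in> - I" for k
      using wt_cr[OF j, of k] that by auto
    then show "pairing l (cr j) = (if i = j then 1 else 0)"
      using j by (simp add: pairing_eq_inner l_def inner_diff_left inner_sum_left wt_cr[of j i])
  next
    fix x assume x: "x \<in> a_M G I"
    have "x = (\<Sum>j\<in>- I. (wt j \<bullet> x) *\<^sub>R central j)"
      using x by (intro mixed_injective) (auto simp: central_sum a_M_iff)
    then have "wt i \<bullet> x = wt i \<bullet> (\<Sum>j\<in>- I. (wt j \<bullet> x) *\<^sub>R central j)"
      by (rule arg_cong)
    also have "\<dots> = (\<Sum>j\<in>- I. (wt i \<bullet> central j) * (wt j \<bullet> x))"
      by (simp add: inner_sum_right mult.commute)
    finally show "pairing l x = 0"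
      by (simp add: pairing_eq_inner l_def inner_diff_left inner_sum_left)
  qed
  moreover have "l' = l" if l': "?P l'" for l'
  proof -
    have cr0: "(l' - l) \<bullet> cr j = 0" if "j \<in> I" for j
      using l' \<open>?P l\<close> that by (simp add: pairing_eq_inner inner_diff_left)
    have "(l' - l) \<bullet> x = 0" for x
    proof -
      define g where "g = (\<Sum>j\<in>- I. (wt j \<bullet> x) *\<^sub>R central j)"
      have "g \<in> a_M G I" by (simp add: g_def a_M_iff central_sum)
      then have "(l' - l) \<bullet> g = 0"
        using l' \<open>?P l\<close> by (simp add: pairing_eq_inner inner_diff_left)
      moreover have "wt j \<bullet> (x - g) = 0" if "j \<notin> I" for j
        using that by (simp add: inner_diff_right g_def central_sum)
      then have "(l' - l) \<bullet> (x - g) = 0"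
        by (subst coroot_expansion) (auto simp: inner_sum_right cr0)
      ultimately show ?thesis by (simp add: inner_diff_right)
    qed
    from this[of "l' - l"] show ?thesis by simp
  qed
  ultimately have "?P (varpi G i)"
    unfolding varpi_def by (intro theI[of ?P l]) blast+
  then show "j \<in> I \<Longrightarrow> varpi G i \<bullet> cr j = (if i = j then 1 else 0)"
    by (simp add: pairing_eq_inner)
qed

lemma varpi_eq_wt:
  assumes "i \<in> I" "\<And>j. j \<notin> I \<Longrightarrow> wt j \<bullet> y = 0"
  shows "pairing (varpi G i) y = wt i \<bullet> y"
proof -
  have "pairing (varpi G i) y = varpi G i \<bullet> (\<Sum>k\<in>I. (wt k \<bullet> y) *\<^sub>R cr k)"
    unfolding pairing_eq_inner
    by (rule arg_cong[OF coroot_expansion[OF assms(2)]])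
  also have "\<dots> = (\<Sum>k\<in>I. if k = i then wt k \<bullet> y else 0)"
    unfolding inner_sum_right
    by (rule sum.cong) (auto simp: varpi_pairing_cr[OF assms(1)])
  finally show ?thesis using assms(1) by simp
qed

section \<open>Points of the adjoint quotient and their valuations\<close>

lemma weyl_char_fixes_chars_D:
  assumes "w \<in> weyl_char G" "l \<in> chars_D G"
  shows "w l' = l \<longleftrightarrow> l' = l"
  using assms(1) unfolding weyl_char_def
proof (induction arbitrary: l' rule: gen_by.induct)
  case (gen_step s w)
  then obtain a where a: "a \<in> roots G" "s = char_refl a (coroot G a)" by auto
  have sl: "s l = l"
    using assms(2) a by (simp add: char_refl_def chars_D_def)
  have ss: "s (s y) = y" for y
    unfolding a(2) by (rule char_refl_involution[OF pairing_root_coroot[OF a(1)]])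
  have "s (w l') = l \<longleftrightarrow> w l' = l" using sl ss by metis
  then show ?case using gen_step.IH by simp
qed simp

lemma orbit_sum_chars_D:
  assumes "l \<in> chars_D G"
  shows "orbit_sum G l = Poly_Mapping.single l 1"
proof -
  have "id \<in> weyl_char G" unfolding weyl_char_def by (rule gen_by.gen_id)
  then have "{w l |w. w \<in> weyl_char G} = {l}"
    using weyl_char_fixes_chars_D[OF _ assms] by (auto intro!: exI[of _ id])
  then show ?thesis by (simp add: orbit_sum_def)
qed

end

locale valued_split_datum = split_datum G \<omega> ip
  for G :: "'n::finite rdatum" and \<omega> ip +
  fixes val :: "'f::field \<Rightarrow> ereal" and \<pi> :: 'f
  assumes dvr: "complete_dvr val \<pi>"
begin

lemma val_0: "val 0 = -\<infinity>"
  and val_int: "x \<noteq> 0 \<Longrightarrow> \<exists>m::int. val x = ereal (of_int m)"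
  and val_mult: "val (x * y) = val x + val y"
  and val_pi: "val \<pi> = -1"
  using dvr by (auto simp: complete_dvr_def discrete_valuation_def)

lemma val_1: "val 1 = 0"
  using val_int[of 1] val_mult[of 1 1] by (auto simp: zero_ereal_def)

lemma val_inverse: "x \<noteq> 0 \<Longrightarrow> val (inverse x) = - val x"
proof -
  assume x: "x \<noteq> 0"
  obtain m n :: int where "val x = ereal m" "val (inverse x) = ereal n"
    using val_int[OF x] val_int[of "inverse x"] x by auto
  moreover have "val x + val (inverse x) = 0"
    using x val_1 val_mult[of x "inverse x"] by simp
  ultimately show ?thesis by (simp add: zero_ereal_def)
qed

lemma pi_nonzero: "\<pi> \<noteq> 0"
  using val_pi val_0 by auto

lemma val_powi: "val (\<pi> powi k) = ereal (- of_int k)"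
proof -
  have pow: "val (\<pi> ^ n) = ereal (- real n)" for n
    by (induction n) (simp_all add: val_1 val_mult val_pi zero_ereal_def one_ereal_def)
  show ?thesis
  proof (cases "0 \<le> k")
    case True
    then show ?thesis by (simp add: power_int_def pow)
  next
    case False
    then show ?thesis
      using pi_nonzero by (simp add: power_int_def pow power_inverse val_inverse)
  qed
qed

lemma pi_power_iff: "x \<in> pi_power val \<pi> j \<longleftrightarrow> val x \<le> ereal (- of_int j)"
proof
  assume "x \<in> pi_power val \<pi> j"
  then obtain y where "x = \<pi> powi j * y" "val y \<le> 0"
    by (auto simp: pi_power_def val_ring_def)
  then show "val x \<le> ereal (- of_int j)"
    by (cases "val y") (auto simp: val_mult val_powi)
next
  assume le: "val x \<le> ereal (- of_int j)"
  have "x = \<pi> powi j * (\<pi> powi (- j) * x)"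
    using pi_nonzero by (simp add: power_int_minus)
  moreover have "val (\<pi> powi (- j) * x) \<le> 0"
    using le by (cases "val x") (auto simp: val_mult val_powi)
  ultimately show "x \<in> pi_power val \<pi> j"
    unfolding pi_power_def val_ring_def by blast
qed

lemma unit_coset_iff:
  assumes t: "t \<noteq> 0"
  shows "(\<exists>u\<in>val_units val. x = t * u) \<longleftrightarrow> val x = val t"
proof
  obtain m :: int where m: "val t = ereal m" using val_int[OF t] by auto
  show "val x = val t" if coset: "\<exists>u\<in>val_units val. x = t * u"
  proof -
    obtain u where u: "x = t * u" "u \<noteq> 0" "val u \<le> 0" "val (inverse u) \<le> 0"
      using coset unfolding val_units_def val_ring_def by blast
    then have "val u = 0" by (simp add: val_inverse)
    then show ?thesis using u(1) by (simp add: val_mult)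
  qed
  assume eq: "val x = val t"
  then have x: "x \<noteq> 0" using m val_0 by auto
  have "val (inverse t * x) = 0"
    using eq m t by (simp add: val_mult val_inverse zero_ereal_def)
  then have "inverse t * x \<in> val_units val"
    using x t val_inverse[of "inverse t * x"] by (simp add: val_units_def val_ring_def)
  moreover have "x = t * (inverse t * x)" using t by simp
  ultimately show "\<exists>u\<in>val_units val. x = t * u" by blast
qed

lemma val_le_floor_iff: "val x \<le> ereal r \<longleftrightarrow> val x \<le> ereal (of_int \<lfloor>r\<rfloor>)"
proof (cases "x = 0")
  case False
  then obtain m :: int where "val x = ereal m" using val_int by blast
  then show ?thesis by (simp add: le_floor_iff)
qed (simp add: val_0)

text \<open>
  For \<open>j \<notin> I\<close> the character \<open>\<omega> j\<close> is invariant under the Weyl group, so its orbit sum is \<open>e\<^bsup>\<omega> j\<^esup>\<close>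
  itself, a unit of the coordinate ring with inverse \<open>e\<^bsup>- \<omega> j\<^esup>\<close>.
\<close>

lemma adj_coord_nonzero:
  assumes c: "c \<in> adj_points G val" and j: "j \<notin> I"
  shows "adj_coord G \<omega> c j \<noteq> 0"
proof -
  have D: "\<omega> j \<in> chars_D G"
    using weights j by (auto simp: extended_weights_def)
  then have D': "- \<omega> j \<in> chars_D G"
    by (simp add: chars_D_def pairing_def sum_negf)
  have inv: "Poly_Mapping.single l 1 \<in> inv_ring G val" if "l \<in> chars_D G" for l
  proof -
    have "l = w l' \<longleftrightarrow> l = l'" if "w \<in> weyl_char G" for w l'
      using weyl_char_fixes_chars_D[OF that \<open>l \<in> chars_D G\<close>, of l'] by auto
    then show ?thesis
      by (simp add: inv_ring_def val_ring_def lookup_single when_def val_1 val_0)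
  qed
  have "c (Poly_Mapping.single (\<omega> j) 1) * c (Poly_Mapping.single (- \<omega> j) 1)
      = c (Poly_Mapping.single (\<omega> j) 1 * Poly_Mapping.single (- \<omega> j) 1)"
    using c inv[OF D] inv[OF D'] by (simp add: adj_points_def)
  also have "\<dots> = c (Poly_Mapping.single 0 1)" by (simp add: mult_single)
  also have "\<dots> = 1"
  proof -
    have "1 \<in> val_ring val" by (simp add: val_ring_def val_1)
    then show ?thesis using c unfolding adj_points_def by blast
  qed
  finally show ?thesis by (auto simp: adj_coord_def orbit_sum_chars_D[OF D])
qed

lemma d_vec_in_ext_domain:
  assumes "c \<in> adj_points G val"
  shows "d_vec G val \<omega> c \<in> ext_domain G"
proof -
  have "val x \<noteq> \<infinity>" for x
    using val_int[of x] val_0 by (cases "x = 0") auto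
  moreover have "val x \<noteq> -\<infinity>" if "x \<noteq> 0" for x
    using val_int[OF that] by auto
  ultimately show ?thesis
    using adj_coord_nonzero[OF assms] by (simp add: ext_domain_def d_vec_def)
qed

lemma adj_le_eq_box:
  assumes b: "b \<in> a_dom G"
    and t: "\<And>j. j \<notin> I \<Longrightarrow> t j \<noteq> 0" "\<And>j. j \<notin> I \<Longrightarrow> val (t j) = ereal (wt j \<bullet> b)"
  shows "adj_le G val ip \<omega> b = adj_box G val \<pi> \<omega> (\<lambda>i. - \<lfloor>wt i \<bullet> b\<rfloor>) t"
proof -
  have "c \<in> adj_points G val \<Longrightarrow> dom_le G (retr_ext G ip \<omega> (d_vec G val \<omega> c)) b \<longleftrightarrow>
      (\<forall>i\<in>I. adj_coord G \<omega> c i \<in> pi_power val \<pi> (- \<lfloor>wt i \<bullet> b\<rfloor>)) \<and>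
      (\<forall>i\<in>- I. \<exists>u\<in>val_units val. adj_coord G \<omega> c i = t i * u)" for c
    by (subst retr_ext_le_iff[OF d_vec_in_ext_domain b], assumption)
      (simp add: d_vec_def pi_power_iff unit_coset_iff t val_le_floor_iff[symmetric])
  then show ?thesis by (auto simp: adj_le_def adj_box_def)
qed

end

theorem mainTheorem4:
  fixes G :: "'n::finite rdatum"
    and \<omega> :: "'n \<Rightarrow> int ^ 'n"
    and ip :: "real ^ 'n \<Rightarrow> real ^ 'n \<Rightarrow> real"
    and val :: "'f::field \<Rightarrow> ereal"
    and \<pi> :: 'f
    and \<mu> :: "int ^ 'n"
    and \<nu> :: "real ^ 'n"
  assumes "complete_dvr val \<pi>"
    and "split_reductive_sc G"
    and "extended_weights G \<omega>"
    and "weyl_inner G ip"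
    and "rvec \<mu> \<in> a_dom G"
    and "\<nu> \<in> N_G G"
    and "dom_le G \<nu> (rvec \<mu>)"
  shows "adj_le G val ip \<omega> \<nu> \<subseteq> adj_le G val ip \<omega> (rvec \<mu>) \<and>
         has_codim G val \<pi> \<omega> (adj_le G val ip \<omega> \<nu>) (adj_le G val ip \<omega> (rvec \<mu>))
           (\<Sum>i\<in>sidx G. \<lceil>pairing (varpi G i) (rvec \<mu> - \<nu>)\<rceil>)"
proof -
  interpret valued_split_datum G \<omega> ip val \<pi>
    using assms by unfold_locales
  have \<nu>_dom: "\<nu> \<in> a_dom G"
  proof -
    obtain K where "K \<subseteq> I" "\<nu> \<in> a_P_plus G K" using assms(6) by (auto simp: N_G_def)
    then show ?thesis
      unfolding a_dom_def a_P_plus_def a_M_def by (auto intro: less_imp_le)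
  qed
  (* nu itself need not be integral, but its D-coordinates are those of mu, so one t serves both. *)
  have D: "wt j \<bullet> \<nu> = wt j \<bullet> rvec \<mu>" if "j \<notin> I" for j
    using assms(7) that by (simp add: dom_le_iff)
  have sub: "adj_le G val ip \<omega> \<nu> \<subseteq> adj_le G val ip \<omega> (rvec \<mu>)"
    using dom_le_trans[OF _ assms(7)] by (auto simp: adj_le_def)
  define t where "t j = \<pi> powi (- pairing (\<omega> j) \<mu>)" for j
  have t: "t j \<noteq> 0" "val (t j) = ereal (wt j \<bullet> rvec \<mu>)" for j
    by (simp_all add: t_def pi_nonzero val_powi rvec_inner)
  let ?j = "\<lambda>b i. - \<lfloor>wt i \<bullet> b\<rfloor>"
  have "adj_le G val ip \<omega> \<nu> = adj_box G val \<pi> \<omega> (?j \<nu>) t"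
    by (rule adj_le_eq_box[OF \<nu>_dom]) (simp_all add: t D)
  moreover have "adj_le G val ip \<omega> (rvec \<mu>) = adj_box G val \<pi> \<omega> (?j (rvec \<mu>)) t"
    by (rule adj_le_eq_box[OF assms(5)]) (simp_all add: t)
  moreover have "(\<Sum>i\<in>I. \<lceil>pairing (varpi G i) (rvec \<mu> - \<nu>)\<rceil>)
      = box_dim G (?j (rvec \<mu>)) - box_dim G (?j \<nu>)"
  proof -
    have "\<lceil>pairing (varpi G i) (rvec \<mu> - \<nu>)\<rceil> = \<lfloor>wt i \<bullet> rvec \<mu>\<rfloor> - \<lfloor>wt i \<bullet> \<nu>\<rfloor>" if "i \<in> I" for i
    proof -
      have "pairing (varpi G i) (rvec \<mu> - \<nu>) = of_int (pairing (\<omega> i) \<mu>) - wt i \<bullet> \<nu>"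
        using that D by (subst varpi_eq_wt) (simp_all add: inner_diff_right rvec_inner)
      then show ?thesis by (simp add: rvec_inner) linarith
    qed
    then show ?thesis by (simp add: box_dim_def sum_negf sum_subtractf)
  qed
  ultimately show ?thesis
    using sub t(1) unfolding has_codim_def by blast
qed

end
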